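(* Let $n \geq 8$ be an even integer. Then $s(n, \mathcal{PM}) \geq \binom{n-4}{2}$, both when Mini moves first and when Max moves first.
   Context: Let $\mathcal{P}$ be a monotone increasing property of graphs on vertex set $[n]$. An edge $e \in \binom{[n]}{2}\setminus E(G)$ is legal with respect to a graph $G \notin \mathcal{P}$ if $G \cup \{e\} \notin \mathcal{P}$. The saturation game $(n,\mathcal{P})$: starting from the empty graph on $[n]$, two players, Mini and Max, alternately add a legal edge to the current graph $G$. The game ends when no legal edge exists. Max wants to maximize the number of edges of the final graph and Mini wants to minimize it. The score $s(n,\mathcal{P})$ is the number of edges of the final graph under optimal play by both players; it may depend on which player moves first. $\mathcal{PM}$ denotes the property of admitting a perfect matching. *)

theory Defs
  imports Complex_Main
begin

text \<open>A graph on the vertex set \<open>{1..n}\<close> is identified with its edge set, a subset of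
  \<open>all_edges n\<close>; a graph property is a set of such graphs.\<close>

type_synonym graph = "nat set set"

definition all_edges :: "nat \<Rightarrow> graph" where
  "all_edges n = {e. e \<subseteq> {1..n} \<and> card e = 2}"

definition monotone_increasing :: "nat \<Rightarrow> graph set \<Rightarrow> bool" where
  "monotone_increasing n P \<longleftrightarrow>
     P \<subseteq> Pow (all_edges n) \<and> (\<forall>G H. G \<in> P \<and> G \<subseteq> H \<and> H \<subseteq> all_edges n \<longrightarrow> H \<in> P)"

definition legal_edges :: "nat \<Rightarrow> graph set \<Rightarrow> graph \<Rightarrow> nat set set" where
  "legal_edges n P G = {e \<in> all_edges n - G. insert e G \<notin> P}"

lemma finite_all_edges [simp]: "finite (all_edges n)"
  unfolding all_edges_def by (rule finite_subset[of _ "Pow {1..n}"]) auto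

lemma finite_legal_edges [simp]: "finite (legal_edges n P G)"
  unfolding legal_edges_def by simp

text \<open>The constructor for the player Max is called \<open>Maxi\<close>, since \<open>Max\<close> is the maximum of a set.\<close>

datatype player = Mini | Maxi

text \<open>\<open>score_from n P p G\<close> is the number of edges of the final graph under optimal play by both
  players when the current graph is \<open>G\<close> and player \<open>p\<close> is to move (backward induction on the
  finite game tree).\<close>

function score_from :: "nat \<Rightarrow> graph set \<Rightarrow> player \<Rightarrow> graph \<Rightarrow> nat" where
  "score_from n P p G =
     (if legal_edges n P G = {} then card G
      else case p of
        Mini \<Rightarrow> Min ((\<lambda>e. score_from n P Maxi (insert e G)) ` legal_edges n P G)
      | Maxi \<Rightarrow> Max ((\<lambda>e. score_from n P Mini (insert e G)) ` legal_edges n P G))"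
  by pat_completeness auto
termination
proof (relation "measure (\<lambda>(n, P, p, G). card (all_edges n - G))", goal_cases)
  case 1
  show ?case by simp
next
  case (2 n P p G e)
  then have "all_edges n - insert e G \<subset> all_edges n - G"
    by (auto simp: legal_edges_def)
  then show ?case by (simp add: psubset_card_mono del: Diff_insert)
next
  case (3 n P p G e)
  then have "all_edges n - insert e G \<subset> all_edges n - G"
    by (auto simp: legal_edges_def)
  then show ?case by (simp add: psubset_card_mono del: Diff_insert)
qed

declare score_from.simps [simp del]

definition score :: "nat \<Rightarrow> graph set \<Rightarrow> player \<Rightarrow> nat" where
  "score n P first = score_from n P first {}"

definition perfect_matching :: "nat \<Rightarrow> nat set set \<Rightarrow> bool" where
  "perfect_matching n M \<longleftrightarrow> M \<subseteq> all_edges n \<and> (\<forall>v\<in>{1..n}. \<exists>!e. e \<in> M \<and> v \<in> e)"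

definition PM :: "nat \<Rightarrow> graph set" where
  "PM n = {G. G \<subseteq> all_edges n \<and> (\<exists>M\<subseteq>G. perfect_matching n M)}"

lemma monotone_increasing_PM: "monotone_increasing n (PM n)"
  unfolding monotone_increasing_def PM_def by blast

lemma empty_notin_PM: "n > 0 \<Longrightarrow> {} \<notin> PM n"
  unfolding PM_def perfect_matching_def by force

end

theory Submission
  imports Defs
begin

text \<open>
  As long as at least five vertices are isolated, Max keeps the non-isolated part of the graph
  traceable. If Mini draws an edge between two isolated vertices, Max links it to an end of the
  Hamilton path; if Mini attaches a new vertex so that traceability is lost, Max closes the path to
  a Hamilton cycle, and cycle plus pendant vertex is traceable again; otherwise Max extends the path.

  With three or four vertices outside the path, Max closes it to a Hamilton cycle and from then on
  answers chords by chords. A Hamilton cycle of odd length is factor-critical, so a position is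
  decided once \<open>n - 1\<close> vertices carry a factor-critical graph (the last vertex stays isolated), once
  \<open>n - 3\<close> vertices do and the other three contain a path, or once a clique on \<open>n - 4\<close>
  vertices is present. In the first two cases all edges inside the factor-critical part remain legal
  until they are played. Every attempt of Mini to use the remaining vertices leads to one of
  these situations.
\<close>

section \<open>Hamilton paths, Hamilton cycles and matchings\<close>

definition is_path :: "graph \<Rightarrow> nat list \<Rightarrow> bool" where
  "is_path G xs \<longleftrightarrow> distinct xs \<and> successively (\<lambda>x y. {x, y} \<in> G) xs"

definition traceable :: "graph \<Rightarrow> nat set \<Rightarrow> bool" where
  "traceable G U \<longleftrightarrow> (\<exists>xs. is_path G xs \<and> set xs = U)"

text \<open>The length bound excludes a single edge, whose two ends would otherwise satisfy the
  closing condition.\<close>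

definition hamiltonian :: "graph \<Rightarrow> nat set \<Rightarrow> bool" where
  "hamiltonian G C \<longleftrightarrow>
     (\<exists>xs. is_path G xs \<and> set xs = C \<and> 3 \<le> length xs \<and> {last xs, hd xs} \<in> G)"

definition complete_on :: "graph \<Rightarrow> nat set \<Rightarrow> bool" where
  "complete_on G U \<longleftrightarrow> (\<forall>e. e \<subseteq> U \<and> card e = 2 \<longrightarrow> e \<in> G)"

text \<open>This says that the vertex set has a perfect matching in \<open>G\<close>. Growing the
  set by two vertices at a time keeps the unique-existence form of \<open>perfect_matching\<close>
  out of the game analysis; \<open>matched_imp_PM\<close> translates at the end.\<close>

inductive matched :: "graph \<Rightarrow> nat set \<Rightarrow> bool" for G where
  empty: "matched G {}"
| add: "matched G A \<Longrightarrow> {x, y} \<in> G \<Longrightarrow> x \<notin> A \<Longrightarrow> y \<notin> A \<Longrightarrow> x \<noteq> y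
    \<Longrightarrow> matched G (insert x (insert y A))"

lemma is_path_mono: "is_path G xs \<Longrightarrow> G \<subseteq> H \<Longrightarrow> is_path H xs"
  unfolding is_path_def by (auto elim: successively_mono)

lemma is_path_append:
  "is_path G (xs @ ys) \<longleftrightarrow> is_path G xs \<and> is_path G ys \<and> set xs \<inter> set ys = {} \<and>
     (xs = [] \<or> ys = [] \<or> {last xs, hd ys} \<in> G)"
  unfolding is_path_def by (auto simp: successively_append_iff)

lemma is_path_Cons:
  "is_path G (x # ys) \<longleftrightarrow> is_path G ys \<and> x \<notin> set ys \<and> (ys = [] \<or> {x, hd ys} \<in> G)"
  using is_path_append[of G "[x]" ys] by (auto simp: is_path_def)

lemma is_path_Nil: "is_path G []"
  by (simp add: is_path_def)

lemma is_path_rev: "is_path G xs \<Longrightarrow> is_path G (rev xs)"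
  unfolding is_path_def by (simp add: successively_rev insert_commute)

lemma traceable_mono: "traceable G U \<Longrightarrow> G \<subseteq> H \<Longrightarrow> traceable H U"
  unfolding traceable_def using is_path_mono by blast

lemma hamiltonian_mono: "hamiltonian G U \<Longrightarrow> G \<subseteq> H \<Longrightarrow> hamiltonian H U"
  unfolding hamiltonian_def using is_path_mono by blast

lemma hamiltonian_imp_traceable: "hamiltonian G U \<Longrightarrow> traceable G U"
  unfolding traceable_def hamiltonian_def by blast

text \<open>The cyclic order is cut just before \<open>x\<close>: in \<open>as @ x # bs\<close> the
  closing edge joins the end of \<open>x # bs\<close> to the start of \<open>as\<close>.\<close>

lemma hamiltonian_path_from:
  assumes "hamiltonian G C" "x \<in> C"
  obtains ys where "is_path G (x # ys)" "set (x # ys) = C"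
proof -
  obtain xs where xs: "is_path G xs" "set xs = C" "{last xs, hd xs} \<in> G"
    using assms(1) unfolding hamiltonian_def by blast
  obtain as bs where s: "xs = as @ x # bs" using assms(2) xs(2) by (metis split_list)
  have "is_path G ((x # bs) @ as)"
    using xs(1,3) unfolding s is_path_append[of G as] is_path_append[of G "x # bs"]
    by (cases as) auto
  moreover have "set ((x # bs) @ as) = C" using xs(2) s by auto
  ultimately show thesis using that by simp
qed

text \<open>The cycle is traversed so that it ends in \<open>x\<close>, and the path then continues
  into \<open>ys\<close>.\<close>

lemma hamiltonian_attach_path:
  assumes "hamiltonian G C" "x \<in> C" "is_path G ys" "ys \<noteq> []" "{x, hd ys} \<in> G" "C \<inter> set ys = {}"
  shows "traceable G (C \<union> set ys)"
proof -
  obtain zs where zs: "is_path G (x # zs)" "set (x # zs) = C"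
    using hamiltonian_path_from[OF assms(1,2)] by blast
  have "is_path G (rev (x # zs) @ ys)"
    using is_path_rev[OF zs(1)] assms zs(2) unfolding is_path_append by auto
  moreover have "set (rev (x # zs) @ ys) = C \<union> set ys" using zs(2) by auto
  ultimately show ?thesis unfolding traceable_def by blast
qed

lemma hamiltonian_attach_edge:
  assumes "hamiltonian G C" "x \<in> C" "{x, y} \<in> G" "y \<notin> C"
  shows "traceable G (insert y C)"
proof -
  have "traceable G (C \<union> set [y])"
    using assms by (intro hamiltonian_attach_path[of _ _ x]) (auto simp: is_path_Cons is_path_Nil)
  then show ?thesis by simp
qed

text \<open>The end \<open>z\<close> of the path is fixed before the supergraph \<open>H\<close>,
  because Max's new edge at \<open>z\<close> depends on \<open>z\<close> and is itself part of
  \<open>H\<close>.\<close>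

lemma traceable_end:
  assumes "traceable G U" "U \<noteq> {}"
  shows "\<exists>z\<in>U. \<forall>H ys. G \<subseteq> H \<longrightarrow> is_path H ys \<longrightarrow> ys \<noteq> [] \<longrightarrow> U \<inter> set ys = {}
    \<longrightarrow> {z, hd ys} \<in> H \<longrightarrow> traceable H (U \<union> set ys)"
proof -
  obtain xs where xs: "is_path G xs" "set xs = U" using assms(1) unfolding traceable_def by blast
  have ne: "xs \<noteq> []" using xs assms(2) by auto
  show ?thesis
  proof (intro bexI[of _ "last xs"] allI impI)
    show "last xs \<in> U" using ne xs by auto
    fix H ys assume "G \<subseteq> H" "is_path H ys" "ys \<noteq> []" "U \<inter> set ys = {}" "{last xs, hd ys} \<in> H"
    then have "is_path H (xs @ ys)" using xs is_path_mono unfolding is_path_append by blast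
    then show "traceable H (U \<union> set ys)" unfolding traceable_def using xs(2) by force
  qed
qed

lemma short_path_complete:
  assumes "is_path G xs" "length xs < 3"
  shows "complete_on G (set xs)"
proof -
  \<comment> \<open>The rule \<open>remdups_adj.cases\<close> serves here only as the case split
    into no, one, or at least two list entries.\<close>
  consider "xs = []" | x where "xs = [x]" | x y where "xs = [x, y]"
    using assms(2) by (cases xs rule: remdups_adj.cases) auto
  then show ?thesis
  proof cases
    case 3
    have "e = {x, y}" if "e \<subseteq> {x, y}" "card e = 2" for e
      using that by (auto simp: card_2_iff)
    then show ?thesis using 3 assms(1) unfolding complete_on_def is_path_def by auto
  qed (auto simp: complete_on_def card_2_iff)
qed

lemma ends_not_equal: "distinct xs \<Longrightarrow> 2 \<le> length xs \<Longrightarrow> last xs \<noteq> hd xs"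
  by (cases xs) auto

lemma close_path:
  assumes "is_path G xs" "3 \<le> length xs"
  shows "hamiltonian (insert {last xs, hd xs} G) (set xs)"
    and "{last xs, hd xs} \<subseteq> set xs" "card {last xs, hd xs} = 2"
proof -
  show "hamiltonian (insert {last xs, hd xs} G) (set xs)"
    unfolding hamiltonian_def using assms is_path_mono[of G xs] by blast
  have "xs \<noteq> []" using assms by auto
  then show "{last xs, hd xs} \<subseteq> set xs" by simp
  show "card {last xs, hd xs} = 2"
    using ends_not_equal[of xs] assms unfolding is_path_def by simp
qed

text \<open>The candidate edge joins the ends of a Hamilton path. If it is already present, any
  absent edge inside \<open>U\<close> does as a waiting move. A path on fewer than three vertices
  cannot be closed, but its vertex set is complete.\<close>

lemma traceable_complete_or_hamiltonian:
  assumes "traceable G U"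
  shows "complete_on G U \<or>
    (\<exists>e. e \<subseteq> U \<and> card e = 2 \<and> e \<notin> G \<and> hamiltonian (insert e G) U)"
proof (cases "complete_on G U")
  case False
  obtain xs where xs: "is_path G xs" "set xs = U" using assms unfolding traceable_def by blast
  have l: "3 \<le> length xs" using short_path_complete[OF xs(1)] False xs(2) by fastforce
  obtain e where e: "e \<subseteq> U" "card e = 2" "e \<notin> G" using False unfolding complete_on_def by blast
  show ?thesis
  proof (cases "{last xs, hd xs} \<in> G")
    case True
    then have "hamiltonian (insert e G) U"
      using close_path(1)[OF xs(1) l] xs(2) hamiltonian_mono by (metis insert_absorb subset_insertI)
    then show ?thesis using e by blast
  next
    case False
    then show ?thesis using close_path[OF xs(1) l] xs(2) by blast
  qed
qed simp

text \<open>A pendant edge at an end extends the path. At an inner vertex Max closes the path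
  instead; if the closing edge is already there, the cycle can be cut at \<open>a\<close> and the
  first alternative holds.\<close>

lemma traceable_pendant:
  assumes "traceable G U" "a \<in> U" "b \<notin> U" "{a, b} \<in> G"
  shows "traceable G (insert b U) \<or>
    (\<exists>e. e \<subseteq> U \<and> card e = 2 \<and> e \<notin> G \<and> hamiltonian (insert e G) U)"
proof -
  obtain xs where xs: "is_path G xs" "set xs = U" using assms(1) unfolding traceable_def by blast
  have ne: "xs \<noteq> []" using xs assms by auto
  consider "a = hd xs" | "a = last xs" | "a \<noteq> hd xs" "a \<noteq> last xs" by blast
  then show ?thesis
  proof cases
    case 1
    then have "is_path G (b # xs)" using xs assms by (auto simp: is_path_Cons insert_commute)
    then show ?thesis unfolding traceable_def using xs(2) by force
  next
    case 2
    then have "is_path G (xs @ [b])" using xs assms by (auto simp: is_path_append is_path_Cons is_path_Nil)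
    then show ?thesis unfolding traceable_def using xs(2) by force
  next
    case 3
    have "\<not> length xs < 3"
    proof
      assume "length xs < 3"
      then have "a = hd xs \<or> a = last xs" using assms(2) xs(2)
        by (cases xs rule: remdups_adj.cases) auto
      then show False using 3 by simp
    qed
    then have l: "3 \<le> length xs" by simp
    show ?thesis
    proof (cases "{last xs, hd xs} \<in> G")
      case True
      then have "hamiltonian G U" using close_path(1)[OF xs(1) l] xs(2) by (simp add: insert_absorb)
      then show ?thesis using hamiltonian_attach_edge[OF _ assms(2,4,3)] by blast
    next
      case False
      then show ?thesis using close_path[OF xs(1) l] xs(2) by blast
    qed
  qed
qed

section \<open>Perfect matchings of vertex sets and parity obstructions\<close>

lemma matched_path: "is_path G xs \<Longrightarrow> even (length xs) \<Longrightarrow> matched G (set xs)"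
proof (induction xs rule: induct_list012)
  case (3 x y zs)
  then have "matched G (set zs)" by (simp add: is_path_Cons)
  then show ?case using 3 by (auto simp: is_path_Cons intro: matched.add)
qed (auto intro: matched.empty)

lemma matched_traceable:
  assumes "traceable G U" "even (card U)"
  shows "matched G U"
proof -
  obtain xs where "is_path G xs" "set xs = U" using assms(1) unfolding traceable_def by blast
  then show ?thesis using matched_path[of G xs] assms(2) distinct_card[of xs]
    unfolding is_path_def by auto
qed

text \<open>An odd cycle is factor-critical: removing \<open>x\<close> leaves a path on an even
  number of vertices, matched in consecutive pairs.\<close>

lemma matched_hamiltonian_delete:
  assumes "hamiltonian G C" "odd (card C)" "x \<in> C"
  shows "matched G (C - {x})"
proof -
  obtain ys where ys: "is_path G (x # ys)" "set (x # ys) = C"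
    using hamiltonian_path_from[OF assms(1,3)] by blast
  have d: "distinct (x # ys)" using ys(1) unfolding is_path_def by blast
  have "even (length ys)" using assms(2) distinct_card[OF d] ys(2) by simp
  moreover have "set ys = C - {x}" using d ys(2) by auto
  ultimately show ?thesis using matched_path[of G ys] ys(1) by (simp add: is_path_Cons)
qed

lemma matched_mono: "matched G A \<Longrightarrow> G \<subseteq> H \<Longrightarrow> matched H A"
  by (induction rule: matched.induct) (auto intro: matched.intros)

lemma matched_imp_matching:
  "matched G A \<Longrightarrow> \<exists>M\<subseteq>G. (\<forall>e\<in>M. e \<subseteq> A) \<and> (\<forall>v\<in>A. \<exists>!e. e \<in> M \<and> v \<in> e)"
proof (induction rule: matched.induct)
  case empty
  show ?case by auto
next
  case (add A x y)
  then obtain M where M: "M \<subseteq> G" "\<forall>e\<in>M. e \<subseteq> A" "\<forall>v\<in>A. \<exists>!e. e \<in> M \<and> v \<in> e" by blast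
  have "\<exists>!e. e \<in> insert {x, y} M \<and> v \<in> e" if v: "v \<in> insert x (insert y A)" for v
  proof (cases "v \<in> A")
    case True
    then have "\<exists>!e. e \<in> M \<and> v \<in> e" "v \<noteq> x" "v \<noteq> y" using M(3) add by auto
    then show ?thesis by auto
  next
    case False
    then show ?thesis using v M(2) by auto
  qed
  moreover have "\<forall>e\<in>insert {x, y} M. e \<subseteq> insert x (insert y A)" using M(2) by auto
  ultimately show ?case using M(1) add.hyps(2) by (intro exI[of _ "insert {x, y} M"]) auto
qed

lemma matched_imp_PM:
  assumes "matched G A" "A = {1..n}" "G \<subseteq> all_edges n"
  shows "G \<in> PM n"
proof -
  obtain M where "M \<subseteq> G" "\<forall>v\<in>{1..n}. \<exists>!e. e \<in> M \<and> v \<in> e"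
    using matched_imp_matching[OF assms(1)] unfolding assms(2) by blast
  then have "perfect_matching n M" "M \<subseteq> G"
    using assms(3) unfolding perfect_matching_def by (blast, blast)
  then show ?thesis using assms(3) unfolding PM_def by blast
qed

text \<open>The set \<open>A\<close> is a union of components of \<open>G\<close>. The edges of a
  perfect matching that lie in \<open>A\<close> would split it into disjoint pairs, against its
  parity. All legality proofs for Max's moves rest on this.\<close>

lemma odd_component_imp_not_PM:
  assumes "A \<subseteq> {1..n}" "odd (card A)" "\<And>e. e \<in> G \<Longrightarrow> e \<subseteq> A \<or> e \<inter> A = {}"
  shows "G \<notin> PM n"
proof
  assume "G \<in> PM n"
  then obtain M where M: "M \<subseteq> G" "M \<subseteq> all_edges n" "\<forall>v\<in>{1..n}. \<exists>!e. e \<in> M \<and> v \<in> e"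
    unfolding PM_def perfect_matching_def by blast
  define N where "N = {e \<in> M. e \<subseteq> A}"
  have fin: "finite N" using M(2) finite_subset[OF _ finite_all_edges] unfolding N_def by auto
  have c2: "card e = 2" if "e \<in> N" for e using that M(2) unfolding N_def all_edges_def by auto
  have "\<Union>N = A"
  proof
    show "A \<subseteq> \<Union>N"
    proof
      fix v assume v: "v \<in> A"
      then obtain e where "e \<in> M" "v \<in> e" using M(3) assms(1) by blast
      then show "v \<in> \<Union>N" using assms(3)[of e] M(1) v unfolding N_def by blast
    qed
  qed (auto simp: N_def)
  moreover have "card (\<Union>N) = (\<Sum>e\<in>N. card e)"
  proof (rule card_Union_disjoint)
    show "pairwise disjnt N"
    proof (rule pairwiseI, unfold disjnt_iff, intro allI notI)
      fix e f v assume "e \<in> N" "f \<in> N" "e \<noteq> f" "v \<in> e \<and> v \<in> f"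
      moreover have "v \<in> {1..n}" using calculation assms(1) unfolding N_def by blast
      ultimately show False using M(3) unfolding N_def by blast
    qed
    show "finite e" if "e \<in> N" for e using c2[OF that] by (metis card.infinite zero_neq_numeral)
  qed
  ultimately have "card A = 2 * card N" using c2 by simp
  then show False using assms(2) by simp
qed

lemma isolated_imp_not_PM:
  assumes "v \<in> {1..n}" "v \<notin> \<Union>G"
  shows "G \<notin> PM n"
  using assms by (intro odd_component_imp_not_PM[of "{v}"]) auto

lemma all_edges_other_end:
  assumes "f \<in> all_edges n" "u \<in> f"
  obtains x where "f = {x, u}" "x \<noteq> u" "x \<in> {1..n}"
proof -
  obtain a b where ab: "f = {a, b}" "a \<noteq> b" "f \<subseteq> {1..n}"
    using assms(1) unfolding all_edges_def card_2_iff by blast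
  then show thesis using that[of a] that[of b] assms(2) by (auto simp: insert_commute)
qed

lemma complete_on_card:
  assumes "complete_on G U" "finite U" "finite G"
  shows "card U choose 2 \<le> card G"
proof -
  have "{e. e \<subseteq> U \<and> card e = 2} \<subseteq> G" using assms(1) unfolding complete_on_def by blast
  then show ?thesis using n_subsets[OF assms(2), of 2] card_mono[OF assms(3)] by metis
qed

section \<open>Scores and strategies\<close>

text \<open>Optimal play from \<open>G\<close> ends in some final position above \<open>G\<close>,
  whoever moves. A bound valid for all such final positions therefore bounds the score without any
  strategy.\<close>

lemma score_from_attained:
  assumes "G \<subseteq> all_edges n" "G \<notin> P"
  shows "\<exists>H. G \<subseteq> H \<and> H \<subseteq> all_edges n \<and> H \<notin> P \<and> legal_edges n P H = {} \<and>
    score_from n P p G = card H"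
  using assms
proof (induction "card (all_edges n - G)" arbitrary: G p rule: less_induct)
  case less
  show ?case
  proof (cases "legal_edges n P G = {}")
    case True
    then have "score_from n P p G = card G" by (subst score_from.simps) simp
    then show ?thesis using less.prems True by blast
  next
    case False
    have "\<exists>e\<in>legal_edges n P G. \<exists>q. score_from n P p G = score_from n P q (insert e G)"
    proof (cases p)
      case Mini
      have "Min ((\<lambda>e. score_from n P Maxi (insert e G)) ` legal_edges n P G)
          \<in> (\<lambda>e. score_from n P Maxi (insert e G)) ` legal_edges n P G"
        using False by (intro Min_in) auto
      moreover have "score_from n P p G = Min ((\<lambda>e. score_from n P Maxi (insert e G)) ` legal_edges n P G)"
        using False Mini by (subst score_from.simps) simp
      ultimately show ?thesis by auto
    next
      case Maxi
      have "Max ((\<lambda>e. score_from n P Mini (insert e G)) ` legal_edges n P G)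
          \<in> (\<lambda>e. score_from n P Mini (insert e G)) ` legal_edges n P G"
        using False by (intro Max_in) auto
      moreover have "score_from n P p G = Max ((\<lambda>e. score_from n P Mini (insert e G)) ` legal_edges n P G)"
        using False Maxi by (subst score_from.simps) simp
      ultimately show ?thesis by auto
    qed
    then obtain e q where e: "e \<in> legal_edges n P G"
      and q: "score_from n P p G = score_from n P q (insert e G)" by blast
    have "all_edges n - insert e G \<subset> all_edges n - G" using e by (auto simp: legal_edges_def)
    then have "card (all_edges n - insert e G) < card (all_edges n - G)"
      by (simp add: psubset_card_mono)
    from less.hyps[OF this, of q] obtain H where "insert e G \<subseteq> H" "H \<subseteq> all_edges n" "H \<notin> P"
      "legal_edges n P H = {}" "score_from n P q (insert e G) = card H"
      using e less.prems unfolding legal_edges_def by auto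
    then show ?thesis using q by auto
  qed
qed

lemma score_from_Maxi_ge:
  assumes "e \<in> legal_edges n P G" "b \<le> score_from n P Mini (insert e G)"
  shows "b \<le> score_from n P Maxi G"
proof -
  have "score_from n P Maxi G = Max ((\<lambda>e. score_from n P Mini (insert e G)) ` legal_edges n P G)"
    using assms(1) by (subst score_from.simps) auto
  moreover have "score_from n P Mini (insert e G) \<le> \<dots>" using assms(1) by (intro Max_ge) auto
  ultimately show ?thesis using assms(2) by simp
qed

lemma score_from_Mini_ge:
  assumes "legal_edges n P G = {} \<Longrightarrow> b \<le> card G"
    and "\<And>e. e \<in> legal_edges n P G \<Longrightarrow> b \<le> score_from n P Maxi (insert e G)"
  shows "b \<le> score_from n P Mini G"
  using assms by (subst score_from.simps) auto

text \<open>A round of two moves lowers the number of absent edges, so \<open>I\<close> can be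
  carried along by induction. The alternatives with \<open>b\<close> let Max stop at a decided
  position; the first of them also covers a game that ends right after Mini's move.\<close>

lemma score_from_Mini_strategy:
  assumes "I G"
    and "\<And>G. I G \<Longrightarrow> legal_edges n P G = {} \<Longrightarrow> b \<le> card G"
    and "\<And>G e. I G \<Longrightarrow> e \<in> legal_edges n P G \<Longrightarrow> b \<le> score_from n P Maxi (insert e G) \<or>
      (\<exists>f\<in>legal_edges n P (insert e G).
        I (insert f (insert e G)) \<or> b \<le> score_from n P Mini (insert f (insert e G)))"
  shows "b \<le> score_from n P Mini G"
  using assms(1)
proof (induction "card (all_edges n - G)" arbitrary: G rule: less_induct)
  case less
  show ?case
  proof (rule score_from_Mini_ge)
    fix e assume e: "e \<in> legal_edges n P G"
    from assms(3)[OF less.prems e] consider "b \<le> score_from n P Maxi (insert e G)"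
      | f where "f \<in> legal_edges n P (insert e G)" "I (insert f (insert e G))"
      | f where "f \<in> legal_edges n P (insert e G)" "b \<le> score_from n P Mini (insert f (insert e G))"
      by blast
    then show "b \<le> score_from n P Maxi (insert e G)"
    proof cases
      case (2 f)
      have "all_edges n - insert f (insert e G) \<subset> all_edges n - G"
        using e by (auto simp: legal_edges_def)
      then have "card (all_edges n - insert f (insert e G)) < card (all_edges n - G)"
        by (simp add: psubset_card_mono)
      then show ?thesis using less.hyps 2 score_from_Maxi_ge by blast
    qed (auto intro: score_from_Maxi_ge)
  qed (use assms(2) less.prems in blast)
qed

section \<open>Decided positions\<close>

text \<open>The outside vertices are kept in a list so that one hypothesis names them, makes them
  distinct and, through \<open>parts_card\<close>, fixes the size of \<open>C\<close>.\<close>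

definition parts :: "nat \<Rightarrow> nat set \<Rightarrow> nat list \<Rightarrow> bool" where
  "parts n C xs \<longleftrightarrow> {1..n} = C \<union> set xs \<and> C \<inter> set xs = {} \<and> distinct xs"

lemma parts_card: "parts n C xs \<Longrightarrow> card C + length xs = n"
proof -
  assume p: "parts n C xs"
  then have e: "{1..n} = C \<union> set xs" and d: "C \<inter> set xs = {}" "distinct xs"
    unfolding parts_def by blast+
  have "C \<subseteq> {1..n}" using e by blast
  then have "finite C" by (rule finite_subset) simp
  then have "card (C \<union> set xs) = card C + length xs"
    using d by (simp add: card_Un_disjoint distinct_card)
  then show ?thesis unfolding e[symmetric] by simp
qed

lemma parts_cong:
  "parts n C xs \<Longrightarrow> set ys = set xs \<Longrightarrow> distinct ys \<Longrightarrow> parts n C ys"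
  unfolding parts_def by auto

lemma parts_same_length:
  assumes "parts n C xs" "set ys \<subseteq> {1..n} - C" "distinct ys" "length ys = length xs"
  shows "parts n C ys"
proof -
  have xs: "{1..n} = C \<union> set xs" "distinct xs" using assms(1) unfolding parts_def by blast+
  have "set ys \<subseteq> set xs" using assms(2) unfolding xs(1) by blast
  moreover have "card (set ys) = card (set xs)" using xs(2) assms(3,4) by (simp add: distinct_card)
  ultimately have "set ys = set xs" by (intro card_subset_eq) auto
  then show ?thesis by (rule parts_cong[OF assms(1) _ assms(3)])
qed

lemma parts_move: "parts n C (x # xs) \<Longrightarrow> parts n (insert x C) xs"
  unfolding parts_def by auto

lemma parts_exists:
  assumes "U \<subseteq> {1..n}" "distinct ys" "set ys \<subseteq> {1..n} - U"
  obtains zs where "parts n U (ys @ zs)"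
proof -
  have "finite ({1..n} - U - set ys)" by simp
  then obtain zs where zs: "set zs = {1..n} - U - set ys" "distinct zs"
    using finite_distinct_list by blast
  have "parts n U (ys @ zs)" unfolding parts_def using zs assms by auto
  then show thesis by (rule that)
qed

text \<open>Mini may pick any outside vertex; listing it first lets \<open>parts_move\<close> absorb
  it into \<open>C\<close>.\<close>

lemma parts_focus:
  assumes "parts n C xs" "y \<in> {1..n}" "y \<notin> C"
  obtains ys where "parts n C (y # ys)" "Suc (length ys) = length xs"
proof -
  have xs: "{1..n} = C \<union> set xs" "C \<inter> set xs = {}" "distinct xs"
    using assms(1) unfolding parts_def by blast+
  have y: "y \<in> set xs" using assms(2,3) xs(1) by blast
  have "set xs = insert y (set (remove1 y xs))" using y xs(3) by auto
  then have "parts n C (y # remove1 y xs)"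
    using xs assms(3) unfolding parts_def by simp
  moreover have "Suc (length (remove1 y xs)) = length xs"
    using length_pos_if_in_set[OF y] y by (simp add: length_remove1)
  ultimately show thesis by (rule that)
qed

text \<open>Both players are allowed to move next, so a decided position can be recognised before as
  well as after Max's reply.\<close>

definition secured :: "nat \<Rightarrow> graph \<Rightarrow> bool" where
  "secured n G \<longleftrightarrow> (\<forall>p. (n - 4) choose 2 \<le> score_from n (PM n) p G)"

lemma complete_on_choose_le_card:
  assumes "complete_on H U" "U \<subseteq> {1..n}" "n - 4 \<le> card U" "H \<subseteq> all_edges n"
  shows "(n - 4) choose 2 \<le> card H"
proof -
  have "card U choose 2 \<le> card H"
    using assms finite_subset[OF assms(2)] finite_subset[OF assms(4)] by (intro complete_on_card) auto
  then show ?thesis using binomial_right_mono[OF assms(3), of 2] by (rule le_trans[rotated])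
qed

text \<open>In a final position above \<open>G\<close> an absent edge inside \<open>C\<close> would
  still be legal, so \<open>C\<close> has become a clique there. By
  \<open>score_from_attained\<close> the size of that clique bounds the score.\<close>

lemma secured_if_safe:
  assumes "G \<subseteq> all_edges n" "G \<notin> PM n" "C \<subseteq> {1..n}" "n - 4 \<le> card C"
    and safe: "\<And>H e. G \<subseteq> H \<Longrightarrow> H \<subseteq> all_edges n \<Longrightarrow> H \<notin> PM n \<Longrightarrow> e \<subseteq> C \<Longrightarrow> card e = 2
      \<Longrightarrow> e \<notin> H \<Longrightarrow> insert e H \<notin> PM n"
  shows "secured n G"
  unfolding secured_def
proof
  fix p
  obtain H where H: "G \<subseteq> H" "H \<subseteq> all_edges n" "H \<notin> PM n" "legal_edges n (PM n) H = {}"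
    "score_from n (PM n) p G = card H" using score_from_attained[OF assms(1,2), of p] by blast
  have "complete_on H C" unfolding complete_on_def
  proof (intro allI impI, rule ccontr)
    fix e assume e: "e \<subseteq> C \<and> card e = 2" "e \<notin> H"
    have "insert e H \<notin> PM n" by (rule safe[OF H(1-3)]) (use e in auto)
    moreover have "e \<in> all_edges n" using e assms(3) unfolding all_edges_def by blast
    ultimately have "e \<in> legal_edges n (PM n) H" using e unfolding legal_edges_def by blast
    then show False using H(4) by simp
  qed
  then show "(n - 4) choose 2 \<le> score_from n (PM n) p G"
    using complete_on_choose_le_card[of H C n] assms(3,4) H by simp
qed

text \<open>The safety premise is vacuous here: no edge of the clique is absent from a supergraph of
  \<open>G\<close>.\<close>

lemma secured_if_complete:
  assumes "complete_on G U" "U \<subseteq> {1..n}" "n - 4 \<le> card U" "G \<subseteq> all_edges n" "G \<notin> PM n"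
  shows "secured n G"
  using assms by (intro secured_if_safe[of G n U]) (auto simp: complete_on_def)

text \<open>The vertex \<open>u\<close> stays isolated for ever: an edge from \<open>x\<close> to
  \<open>u\<close> together with the matching of \<open>C - {x}\<close> would be a perfect matching.
  Edges inside \<open>C\<close> keep \<open>u\<close> isolated and hence are legal.\<close>

lemma secured_if_factor_critical:
  assumes "parts n C [u]" "\<And>x. x \<in> C \<Longrightarrow> matched G (C - {x})" "G \<subseteq> all_edges n" "G \<notin> PM n"
  shows "secured n G"
proof (rule secured_if_safe[of G n C])
  have p: "{1..n} = C \<union> {u}" "u \<notin> C" using assms(1) unfolding parts_def by auto
  show "n - 4 \<le> card C" using parts_card[OF assms(1)] by simp
  show "C \<subseteq> {1..n}" using p by blast
  fix H e assume H: "G \<subseteq> H" "H \<subseteq> all_edges n" "H \<notin> PM n" "e \<subseteq> C" "card e = 2"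
  have "u \<notin> \<Union>(insert e H)"
  proof
    assume "u \<in> \<Union>(insert e H)"
    then obtain f where f: "u \<in> f" "f \<in> H" using H(4) p(2) by auto
    obtain x where x: "f = {x, u}" "x \<noteq> u" "x \<in> {1..n}"
      by (rule all_edges_other_end[OF subsetD[OF H(2) f(2)] f(1)])
    have xC: "x \<in> C" using p(1) x(2,3) by blast
    have "matched H (insert x (insert u (C - {x})))"
      using f x p(2) xC by (intro matched.add[OF matched_mono[OF assms(2)[OF xC] H(1)]]) simp_all
    moreover have "insert x (insert u (C - {x})) = {1..n}" using p(1) xC by auto
    ultimately show False using matched_imp_PM[OF _ _ H(2)] H(3) by blast
  qed
  then show "insert e H \<notin> PM n" by (rule isolated_imp_not_PM[rotated]) (use p in blast)
qed (fact assms)+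

lemma matched_add2:
  assumes "matched G A" "{x, y} \<in> G" "{z, w} \<in> G" "distinct [x, y, z, w]" "A \<inter> {x, y, z, w} = {}"
  shows "matched G (insert x (insert y (insert z (insert w A))))"
  using assms by (intro matched.add) auto

text \<open>As \<open>C\<close> is factor-critical, an edge from \<open>C\<close> to \<open>u\<close> or \<open>t\<close> completes a perfect matching,
  so either \<open>C\<close> remains an odd component or \<open>u\<close> and \<open>t\<close> remain leaves at \<open>w\<close>; adding
  an edge inside \<open>C\<close> is legal in both cases.\<close>

lemma secured_if_hamiltonian_cherry:
  assumes "even n" "parts n C [u, w, t]" "hamiltonian G C" "{u, w} \<in> G" "{w, t} \<in> G"
    "G \<subseteq> all_edges n" "G \<notin> PM n"
  shows "secured n G"
proof (rule secured_if_safe[of G n C])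
  have p: "{1..n} = C \<union> {u, w, t}" "distinct [u, w, t]" "C \<inter> {u, w, t} = {}"
    using assms(2) unfolding parts_def by auto
  show "n - 4 \<le> card C" using parts_card[OF assms(2)] by simp
  show CV: "C \<subseteq> {1..n}" using p by auto
  have oddC: "odd (card C)" using parts_card[OF assms(2)] assms(1) by auto
  fix H e assume H: "G \<subseteq> H" "H \<subseteq> all_edges n" "H \<notin> PM n" "e \<subseteq> C" "card e = 2"
  \<comment> \<open>Two such edges complete a perfect matching: \<open>x\<close> goes with
    \<open>y\<close>, the other two outside vertices go with each other, and \<open>C - {x}\<close>
    is matched along the odd cycle.\<close>
  have C_pair: False if "x \<in> C" "{x, y} \<in> H" "{z, z'} \<in> H" "{u, w, t} = {y, z, z'}" for x y z z'
  proof -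
    have "card {y, z, z'} = 3" using p(2) unfolding that(4)[symmetric] by simp
    then have d: "distinct [y, z, z']" by (auto simp: card_insert_if split: if_splits)
    have "matched H (insert x (insert y (insert z (insert z' (C - {x})))))"
    proof (rule matched_add2)
      show "matched H (C - {x})"
        using matched_mono[OF matched_hamiltonian_delete[OF assms(3) oddC that(1)] H(1)] .
      have "x \<notin> {u, w, t}" "C \<inter> {y, z, z'} = {}" using p(3) that by auto
      then show "distinct [x, y, z, z']" "(C - {x}) \<inter> {x, y, z, z'} = {}"
        using d unfolding that(4) by auto
    qed (use that in auto)
    moreover have "insert x (insert y (insert z (insert z' (C - {x})))) = {1..n}"
      using that(1) unfolding p(1) that(4) by auto
    ultimately show False using matched_imp_PM[OF _ _ H(2)] H(3) by blast
  qed
  show "insert e H \<notin> PM n"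
  proof (cases "\<exists>x\<in>C. {x, w} \<in> H")
    case True
    then obtain x where x: "x \<in> C" "{x, w} \<in> H" by blast
    have nut: "{u, t} \<notin> H" using C_pair[of x w u t] x by auto
    have leaf: "f = {w, v}" if f: "f \<in> insert e H" "v \<in> f" "v \<in> {u, t}" for f v
    proof -
      have fH: "f \<in> H" using f H(4) p by auto
      obtain y where y: "f = {y, v}" "y \<noteq> v" "y \<in> {1..n}"
        by (rule all_edges_other_end[OF subsetD[OF H(2) fH] f(2)])
      have "y \<notin> C"
      proof
        assume "y \<in> C"
        then show False using C_pair[of y u w t] C_pair[of y t u w] fH y(1) f(3) assms(4,5) H(1)
          by auto
      qed
      moreover have "y \<notin> {u, t}" using nut fH y f(3) by (auto simp: insert_commute)
      ultimately have "y = w" using y(3) unfolding p(1) by blast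
      then show ?thesis using y(1) by simp
    qed
    show ?thesis
    proof
      assume "insert e H \<in> PM n"
      then obtain M where M: "M \<subseteq> insert e H" "\<forall>v\<in>{1..n}. \<exists>!f. f \<in> M \<and> v \<in> f"
        unfolding PM_def perfect_matching_def by blast
      have V: "u \<in> {1..n}" "t \<in> {1..n}" "w \<in> {1..n}" using p by auto
      obtain f where f: "f \<in> M" "u \<in> f" using M(2) V by blast
      obtain g where g: "g \<in> M" "t \<in> g" using M(2) V by blast
      \<comment> \<open>Both \<open>u\<close> and \<open>t\<close> have \<open>w\<close> as their
        only neighbour, so a perfect matching would have to cover \<open>w\<close> twice.\<close>
      have fg: "f = {w, u}" "g = {w, t}" using leaf f g M(1) by (blast, blast)
      have "f = g" using M(2) V(3) f(1) g(1) unfolding fg by blast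
      then show False using p(2) unfolding fg by (auto simp: doubleton_eq_iff)
    qed
  next
    case False
    have "f \<subseteq> C \<or> f \<inter> C = {}" if "f \<in> insert e H" for f
    proof (rule ccontr)
      assume f: "\<not> (f \<subseteq> C \<or> f \<inter> C = {})"
      then have fH: "f \<in> H" using that H(4) by blast
      obtain x where x: "x \<in> f" "x \<in> C" using f by blast
      obtain y where y: "f = {y, x}" "y \<noteq> x" "y \<in> {1..n}"
        by (rule all_edges_other_end[OF subsetD[OF H(2) fH] x(1)])
      have xy: "{x, y} \<in> H" using fH unfolding y(1) by (simp add: insert_commute)
      have "y \<notin> C" using f x(2) unfolding y(1) by blast
      then consider "y = u" | "y = w" | "y = t" using y(3) unfolding p(1) by blast
      then show False
      proof cases
        case 1
        then show False using C_pair[of x u w t] x(2) xy assms(5) H(1) by blast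
      next
        case 2
        then show False using False x(2) xy by blast
      next
        case 3
        then show False using C_pair[of x t u w] x(2) xy assms(4) H(1) by blast
      qed
    qed
    then show ?thesis using odd_component_imp_not_PM[OF CV oddC] by blast
  qed
qed (fact assms)+

lemma secured_if_hamiltonian:
  assumes "even n" "parts n C [u]" "hamiltonian G C" "G \<subseteq> all_edges n" "G \<notin> PM n"
  shows "secured n G"
proof (rule secured_if_factor_critical[OF assms(2) _ assms(4,5)])
  fix x assume "x \<in> C"
  moreover have "odd (card C)" using parts_card[OF assms(2)] assms(1) by auto
  ultimately show "matched G (C - {x})" using matched_hamiltonian_delete[OF assms(3)] by blast
qed

section \<open>The strategy of Max\<close>

text \<open>The positions Max hands over to Mini. In every clause but \<open>path\<close> the listed vertices
  outside \<open>C\<close> determine the parity of \<open>card C\<close>, since \<open>n\<close> is even.\<close>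

inductive mini_state :: "nat \<Rightarrow> graph \<Rightarrow> bool" for n G where
  path: "traceable G U \<Longrightarrow> U \<noteq> {} \<Longrightarrow> \<Union>G \<subseteq> U \<Longrightarrow> U \<subseteq> {1..n} \<Longrightarrow> card U + 3 \<le> n
    \<Longrightarrow> mini_state n G"
| cycle: "hamiltonian G C \<Longrightarrow> \<Union>G \<subseteq> C \<Longrightarrow> parts n C [u, v] \<Longrightarrow> mini_state n G"
| cycle_pendant: "hamiltonian G C \<Longrightarrow> p \<in> C \<Longrightarrow> {p, w} \<in> G \<Longrightarrow> \<Union>G \<subseteq> insert w C
    \<Longrightarrow> parts n C [w, u, v] \<Longrightarrow> mini_state n G"
| odd_cycle_edge: "hamiltonian G C \<Longrightarrow> {w, t} \<in> G \<Longrightarrow> G \<subseteq> Pow C \<union> {{w, t}}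
    \<Longrightarrow> parts n C [w, t, u] \<Longrightarrow> mini_state n G"
| even_cycle_edge: "hamiltonian G C \<Longrightarrow> {w, t} \<in> G \<Longrightarrow> G \<subseteq> Pow C \<union> {{w, t}}
    \<Longrightarrow> parts n C [w, t, u, v] \<Longrightarrow> mini_state n G"
| cycle_triangle: "hamiltonian G C \<Longrightarrow> {w, t} \<in> G \<Longrightarrow> {t, u} \<in> G \<Longrightarrow> {w, u} \<in> G
    \<Longrightarrow> G \<subseteq> Pow C \<union> Pow {w, t, u} \<Longrightarrow> parts n C [w, t, u, v] \<Longrightarrow> mini_state n G"

text \<open>These are the positions with Max to move. The first disjunct asks for no reply, since in
  a decided position there may be no legal edge left.\<close>

definition answerable :: "nat \<Rightarrow> graph \<Rightarrow> bool" where
  "answerable n G \<longleftrightarrow> secured n G \<or>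
    (\<exists>f\<in>legal_edges n (PM n) G. secured n (insert f G) \<or> mini_state n (insert f G))"

lemma mini_state_isolated_vertex:
  assumes "mini_state n G"
  obtains v where "v \<in> {1..n}" "v \<notin> \<Union>G"
  using assms
proof cases
  case (path U)
  have "card U < card {1..n}" using path by simp
  then have "\<not> {1..n} \<subseteq> U" using card_mono[OF finite_subset[OF path(4)], of "{1..n}"] by auto
  then show thesis using that path(3) by blast
next
  case (cycle C u v)
  have "v \<in> {1..n}" "v \<notin> C" using cycle(3) unfolding parts_def by auto
  then show thesis using that[of v] cycle(2) by blast
next
  case (cycle_pendant C p w u v)
  have "v \<in> {1..n}" "v \<notin> insert w C" using cycle_pendant(5) unfolding parts_def by auto
  then show thesis using that[of v] cycle_pendant(4) by blast
next
  case (odd_cycle_edge C w t u)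
  have "u \<in> {1..n}" "u \<notin> C \<union> {w, t}" using odd_cycle_edge(4) unfolding parts_def by auto
  then show thesis using that[of u] odd_cycle_edge(3) by blast
next
  case (even_cycle_edge C w t u v)
  have "u \<in> {1..n}" "u \<notin> C \<union> {w, t}" using even_cycle_edge(4) unfolding parts_def by auto
  then show thesis using that[of u] even_cycle_edge(3) by blast
next
  case (cycle_triangle C w t u v)
  have "v \<in> {1..n}" "v \<notin> C \<union> {w, t, u}" using cycle_triangle(6) unfolding parts_def by auto
  then show thesis using that[of v] cycle_triangle(5) by blast
qed

text \<open>With \<open>v\<close> isolated, every absent edge that avoids \<open>v\<close> is legal.
  A final position thus contains a clique on the other \<open>n - 1\<close> vertices.\<close>

lemma mini_state_final:
  assumes "mini_state n G" "G \<subseteq> all_edges n" "legal_edges n (PM n) G = {}"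
  shows "(n - 4) choose 2 \<le> card G"
proof -
  obtain v where v: "v \<in> {1..n}" "v \<notin> \<Union>G" using mini_state_isolated_vertex[OF assms(1)] by blast
  have "complete_on G ({1..n} - {v})" unfolding complete_on_def
  proof (intro allI impI, rule ccontr)
    fix e assume e: "e \<subseteq> {1..n} - {v} \<and> card e = 2" "e \<notin> G"
    have "insert e G \<notin> PM n" by (rule isolated_imp_not_PM[OF v(1)]) (use e v(2) in blast)
    moreover have "e \<in> all_edges n" using e unfolding all_edges_def by blast
    ultimately have "e \<in> legal_edges n (PM n) G" using e(2) unfolding legal_edges_def by blast
    then show False using assms(3) by blast
  qed
  then show ?thesis
    using v(1) assms(2) by (elim complete_on_choose_le_card) auto
qed

section \<open>Legality and effect of Max's closing move\<close>

lemma answerable_by_edge: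
  assumes "f \<subseteq> {1..n}" "card f = 2" "f \<notin> G" "insert f G \<notin> PM n"
    "secured n (insert f G) \<or> mini_state n (insert f G)"
  shows "answerable n G"
  using assms unfolding answerable_def legal_edges_def all_edges_def by blast

text \<open>The closing edge lies in \<open>U\<close>, which does not cross the boundary of the odd
  set \<open>A\<close>; so \<open>A\<close> remains a union of components and the move is legal. If
  \<open>U\<close> is already complete, the position is decided. Only the position after closing is
  left to the premise \<open>cont\<close>.\<close>

lemma answerable_by_closing:
  assumes "traceable G U" "U \<subseteq> {1..n}" "n - 4 \<le> card U" "G \<subseteq> all_edges n"
    and A: "A \<subseteq> {1..n}" "odd (card A)" "\<And>e. e \<in> G \<Longrightarrow> e \<subseteq> A \<or> e \<inter> A = {}" "U \<subseteq> A \<or> U \<inter> A = {}"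
    and cont: "\<And>f. f \<subseteq> U \<Longrightarrow> insert f G \<subseteq> all_edges n \<Longrightarrow> insert f G \<notin> PM n
      \<Longrightarrow> hamiltonian (insert f G) U \<Longrightarrow> secured n (insert f G) \<or> mini_state n (insert f G)"
  shows "answerable n G"
proof -
  have "G \<notin> PM n" using odd_component_imp_not_PM[OF A(1,2)] A(3) by blast
  from traceable_complete_or_hamiltonian[OF assms(1)] show ?thesis
  proof
    assume "complete_on G U"
    then have "secured n G" by (rule secured_if_complete) (fact+)
    then show ?thesis unfolding answerable_def by blast
  next
    assume "\<exists>f. f \<subseteq> U \<and> card f = 2 \<and> f \<notin> G \<and> hamiltonian (insert f G) U"
    then obtain f where f: "f \<subseteq> U" "card f = 2" "f \<notin> G" "hamiltonian (insert f G) U" by blast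
    have nPM: "insert f G \<notin> PM n"
      using odd_component_imp_not_PM[OF A(1,2), of "insert f G"] A(3,4) f(1) by blast
    have fn: "f \<subseteq> {1..n}" using f(1) assms(2) by blast
    then have "insert f G \<subseteq> all_edges n" using assms(4) f(2) unfolding all_edges_def by blast
    then show ?thesis using answerable_by_edge[OF fn f(2,3) nPM] cont[OF f(1) _ nPM f(4)] by blast
  qed
qed

lemma answerable_by_closing_isolated:
  assumes "traceable G U" "U \<subseteq> {1..n}" "n - 4 \<le> card U" "G \<subseteq> all_edges n"
    and v: "v \<in> {1..n}" "v \<notin> U" "v \<notin> \<Union>G"
    and cont: "\<And>f. f \<subseteq> U \<Longrightarrow> insert f G \<subseteq> all_edges n \<Longrightarrow> insert f G \<notin> PM n
      \<Longrightarrow> hamiltonian (insert f G) U \<Longrightarrow> secured n (insert f G) \<or> mini_state n (insert f G)"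
  shows "answerable n G"
  by (rule answerable_by_closing[OF assms(1-4), of "{v}"]) (use v cont in auto)

text \<open>Closing the path yields a cycle on the odd number \<open>n - 1\<close> of vertices,
  which is factor-critical, so the position is decided.\<close>

lemma answerable_traceable_minus_one:
  assumes "even n" "traceable G U" "parts n U [v]" "v \<notin> \<Union>G" "G \<subseteq> all_edges n"
  shows "answerable n G"
proof (rule answerable_by_closing_isolated[OF assms(2), of n v])
  show "U \<subseteq> {1..n}" "v \<in> {1..n}" "v \<notin> U" using assms(3) unfolding parts_def by auto
  show "n - 4 \<le> card U" using parts_card[OF assms(3)] by simp
  fix f assume "insert f G \<subseteq> all_edges n" "insert f G \<notin> PM n" "hamiltonian (insert f G) U"
  then have "secured n (insert f G)" by (intro secured_if_hamiltonian[OF assms(1,3)])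
  then show "secured n (insert f G) \<or> mini_state n (insert f G)" ..
qed fact+

text \<open>The two vertices outside \<open>U\<close> are isolated, so closing is legal and leads to
  the state \<open>cycle\<close>.\<close>

lemma answerable_traceable_minus_two:
  assumes "traceable G U" "parts n U [u, v]" "\<Union>G \<subseteq> U" "G \<subseteq> all_edges n"
  shows "answerable n G"
proof (rule answerable_by_closing_isolated[OF assms(1), of n v])
  show "U \<subseteq> {1..n}" "v \<in> {1..n}" and v: "v \<notin> U" using assms(2) unfolding parts_def by auto
  show "n - 4 \<le> card U" using parts_card[OF assms(2)] by simp
  show "v \<notin> \<Union>G" using v assms(3) by blast
  fix f assume "f \<subseteq> U" "hamiltonian (insert f G) U"
  then have "mini_state n (insert f G)" using assms by (intro mini_state.cycle[where C = U and u = u and v = v]) auto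
  then show "secured n (insert f G) \<or> mini_state n (insert f G)" ..
qed fact

section \<open>Max's answers in the cycle states\<close>

lemma legal_edge_cases:
  assumes "e \<in> legal_edges n (PM n) G" "G \<subseteq> all_edges n"
  obtains (inside) x y where "e = {x, y}" "x \<noteq> y" "e \<subseteq> C" "insert e G \<subseteq> all_edges n"
  | (crossing) x y where "e = {x, y}" "x \<in> C" "y \<notin> C" "x \<in> {1..n}" "y \<in> {1..n}"
      "insert e G \<subseteq> all_edges n"
  | (outside) x y where "e = {x, y}" "x \<noteq> y" "x \<notin> C" "y \<notin> C" "x \<in> {1..n}" "y \<in> {1..n}"
      "insert e G \<subseteq> all_edges n"
proof -
  have e: "e \<in> all_edges n" using assms(1) unfolding legal_edges_def by blast
  then have H: "insert e G \<subseteq> all_edges n" using assms(2) by blast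
  obtain x y where xy: "e = {x, y}" "x \<noteq> y" "e \<subseteq> {1..n}"
    using e unfolding all_edges_def card_2_iff by blast
  have n: "x \<in> {1..n}" "y \<in> {1..n}" using xy by auto
  consider "x \<in> C" "y \<in> C" | "x \<in> C" "y \<notin> C" | "x \<notin> C" "y \<in> C" | "x \<notin> C" "y \<notin> C" by blast
  then show thesis
  proof cases
    case 1
    then show ?thesis using inside[OF xy(1,2) _ H] xy(1) by simp
  next
    case 2
    then show ?thesis using crossing[OF xy(1) _ _ n H] by simp
  next
    case 3
    then show ?thesis using crossing[of y x] xy(1) n H by (simp add: insert_commute)
  next
    case 4
    then show ?thesis using outside[OF xy(1,2) _ _ n H] by simp
  qed
qed

lemma legal_not_matched:
  assumes "e \<in> legal_edges n (PM n) G" "insert e G \<subseteq> all_edges n" "matched (insert e G) A"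
  shows "A \<noteq> {1..n}"
  using matched_imp_PM[OF assms(3) _ assms(2)] assms(1) unfolding legal_edges_def by blast

text \<open>Here \<open>C\<close> has even size. A chord keeps two vertices outside a traceable set,
  an edge leaving \<open>C\<close> makes all but one vertex traceable, and the edge between the two
  outside vertices is illegal because it completes a perfect matching.\<close>

lemma answerable_cycle:
  assumes "even n" "hamiltonian G C" "\<Union>G \<subseteq> C" "parts n C [u, v]"
    "G \<subseteq> all_edges n" "e \<in> legal_edges n (PM n) G"
  shows "answerable n (insert e G)"
  using assms(6,5)
proof (cases rule: legal_edge_cases[where C = C])
  case (inside x y)
  have "traceable (insert e G) C"
    using hamiltonian_imp_traceable[OF assms(2)] by (rule traceable_mono) blast
  then show ?thesis
    by (rule answerable_traceable_minus_two[OF _ assms(4)]) (use inside assms(3) in auto)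
next
  case (crossing x y)
  obtain ys where ys: "parts n C (y # ys)" "Suc (length ys) = length [u, v]"
    using parts_focus[OF assms(4) crossing(5,3)] by blast
  then obtain v' where ys': "ys = [v']" by (cases ys) auto
  have p: "v' \<notin> C" "v' \<noteq> y" using ys unfolding ys' parts_def by auto
  have "traceable (insert e G) (insert y C)"
    using hamiltonian_mono[OF assms(2), of "insert e G"] crossing
    by (intro hamiltonian_attach_edge[of _ _ x]) auto
  then show ?thesis
  proof (rule answerable_traceable_minus_one[OF assms(1)])
    show "parts n (insert y C) [v']" using parts_move ys(1) unfolding ys' .
    show "v' \<notin> \<Union>(insert e G)" using p crossing(1,2) assms(3) by auto
  qed fact
next
  case (outside x y)
  have "even (card C)" using parts_card[OF assms(4)] assms(1) by auto
  then have "matched G C" using hamiltonian_imp_traceable[OF assms(2)] matched_traceable by blast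
  then have "matched (insert e G) (insert x (insert y C))"
    using outside matched_mono[of G C "insert e G"] by (intro matched.add) auto
  moreover have "parts n C [x, y]" by (rule parts_same_length[OF assms(4)]) (use outside in simp_all)
  then have "insert x (insert y C) = {1..n}" unfolding parts_def by simp
  ultimately show ?thesis using legal_not_matched[OF assms(6) outside(7)] by blast
qed

text \<open>Here \<open>C\<close> has odd size. An edge inside \<open>insert w C\<close> leaves a
  traceable set missing two vertices. A new vertex attached to \<open>w\<close> prolongs the tail of
  the cycle, and one attached to \<open>C\<close> is a second pendant vertex. The edge between the
  two isolated vertices would complete a perfect matching.\<close>

lemma answerable_cycle_pendant:
  assumes "even n" "hamiltonian G C" "p \<in> C" "{p, w} \<in> G" "\<Union>G \<subseteq> insert w C"
    "parts n C [w, u, v]" "G \<subseteq> all_edges n" "e \<in> legal_edges n (PM n) G"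
  shows "answerable n (insert e G)"
  using assms(8,7)
proof (cases rule: legal_edge_cases[where C = "insert w C"])
  case (inside x y)
  have wC: "w \<notin> C" using assms(6) unfolding parts_def by simp
  have "traceable G (insert w C)" by (rule hamiltonian_attach_edge[OF assms(2-4) wC])
  then have "traceable (insert e G) (insert w C)" by (rule traceable_mono) blast
  then show ?thesis
    by (rule answerable_traceable_minus_two[OF _ parts_move[OF assms(6)]])
      (use inside assms(5) in auto)
next
  case (crossing x y)
  obtain ys where ys: "parts n (insert w C) (y # ys)" "Suc (length ys) = length [u, v]"
    using parts_focus[OF parts_move[OF assms(6)] crossing(5,3)] by blast
  then obtain v' where ys': "ys = [v']" by (cases ys) auto
  have wC: "w \<notin> C" using assms(6) unfolding parts_def by simp
  have p: "v' \<notin> insert w C" "v' \<noteq> y" "v' \<in> {1..n}" using ys unfolding ys' parts_def by auto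
  have p': "parts n (insert y (insert w C)) [v']" using parts_move ys(1) unfolding ys' .
  have iso: "v' \<notin> \<Union>(insert e G)" using p crossing(1,2) assms(5) by auto
  have ham: "hamiltonian (insert e G) C" using assms(2) by (rule hamiltonian_mono) blast
  show ?thesis
  proof (cases "x = w")
    case True
    have "traceable (insert e G) (C \<union> set [w, y])"
      by (rule hamiltonian_attach_path[OF ham assms(3)])
        (use assms(4) True crossing wC in \<open>auto simp: is_path_Cons is_path_Nil\<close>)
    moreover have "C \<union> set [w, y] = insert y (insert w C)" by auto
    ultimately show ?thesis
      using answerable_traceable_minus_one[OF assms(1) _ p' iso crossing(6)] by simp
  next
    case False
    then have xC: "x \<in> C" using crossing(2) by simp
    have oddC: "odd (card C)" using parts_card[OF assms(6)] assms(1) by auto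
    \<comment> \<open>Joining the two pendant vertices \<open>w\<close> and \<open>y\<close> adds an odd ear to the factor-critical \<open>C\<close>.\<close>
    let ?H = "insert {w, y} (insert e G)"
    have yw: "y \<noteq> w" "y \<notin> C" using crossing(3) by auto
    have wn: "w \<in> {1..n}" using assms(6) unfolding parts_def by auto
    have del: "matched ?H (C - {z})" if "z \<in> C" for z
      using matched_hamiltonian_delete[OF assms(2) oddC that] by (rule matched_mono) blast
    show ?thesis
    proof (rule answerable_by_edge)
      show "{w, y} \<subseteq> {1..n}" using wn crossing(5) by blast
      show "card {w, y} = 2" using yw by simp
      show "{w, y} \<notin> insert e G"
        using assms(5) crossing(1,3) xC yw wC by (auto simp: doubleton_eq_iff)
      have "v' \<notin> \<Union>?H" using iso p by blast
      then show nPM: "?H \<notin> PM n" by (rule isolated_imp_not_PM[OF p(3)])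
      have "secured n ?H"
      proof (rule secured_if_factor_critical[OF p' _ _ nPM])
        show "?H \<subseteq> all_edges n"
          using crossing(6) wn crossing(5) yw unfolding all_edges_def by auto
        fix z assume z: "z \<in> insert y (insert w C)"
        \<comment> \<open>If \<open>z\<close> lies in \<open>C\<close>, the new edge matches
          \<open>w\<close> with \<open>y\<close>; if \<open>w\<close> is deleted, \<open>y\<close>
          goes with \<open>x\<close>; if \<open>y\<close> is deleted, \<open>w\<close> goes with
          \<open>p\<close>.\<close>
        consider "z \<in> C" | "z = w" | "z = y" using z by blast
        then show "matched ?H (insert y (insert w C) - {z})"
        proof cases
          case 1
          have "matched ?H (insert y (insert w (C - {z})))"
            using yw wC by (intro matched.add[OF del[OF 1]]) (auto simp: insert_commute)
          moreover have "insert y (insert w (C - {z})) = insert y (insert w C) - {z}"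
            using 1 yw wC by auto
          ultimately show ?thesis by simp
        next
          case 2
          have "matched ?H (insert x (insert y (C - {x})))"
            using yw xC crossing(1) by (intro matched.add[OF del[OF xC]]) auto
          moreover have "insert x (insert y (C - {x})) = insert y (insert w C) - {z}"
            using 2 yw wC xC by auto
          ultimately show ?thesis by simp
        next
          case 3
          have "matched ?H (insert p (insert w (C - {p})))"
            using wC assms(3,4) by (intro matched.add[OF del[OF assms(3)]]) auto
          moreover have "insert p (insert w (C - {p})) = insert y (insert w C) - {z}"
            using 3 yw wC assms(3) by auto
          ultimately show ?thesis by simp
        qed
      qed
      then show "secured n ?H \<or> mini_state n ?H" ..
    qed
  qed
next
  case (outside x y)
  have oddC: "odd (card C)" using parts_card[OF assms(6)] assms(1) by auto
  have wC: "w \<notin> C" using assms(6) unfolding parts_def by simp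
  have "matched (insert e G) (C - {p})"
    using matched_hamiltonian_delete[OF assms(2) oddC assms(3)] by (rule matched_mono) blast
  then have "matched (insert e G) (insert p (insert w (insert x (insert y (C - {p})))))"
    by (rule matched_add2) (use outside(1-4) assms(3,4) wC in auto)
  moreover have "parts n (insert w C) [x, y]"
    by (rule parts_same_length[OF parts_move[OF assms(6)]]) (use outside in simp_all)
  then have V: "{1..n} = insert w C \<union> {x, y}" unfolding parts_def by simp
  have "insert p (insert w (insert x (insert y (C - {p})))) = {1..n}"
    unfolding V using assms(3) by blast
  ultimately show ?thesis using legal_not_matched[OF assms(8) outside(7)] by blast
qed

text \<open>A chord is answered inside \<open>C\<close>. An edge from \<open>C\<close> to
  \<open>u\<close> is illegal, and one to \<open>w\<close> or \<open>t\<close> gives a Hamilton path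
  of everything but \<open>u\<close>. An edge from \<open>u\<close> to \<open>w\<close> or
  \<open>t\<close> creates the cherry of \<open>secured_if_hamiltonian_cherry\<close>.\<close>

lemma answerable_odd_cycle_edge:
  assumes "even n" "hamiltonian G C" "{w, t} \<in> G" "G \<subseteq> Pow C \<union> {{w, t}}"
    "parts n C [w, t, u]" "G \<subseteq> all_edges n" "e \<in> legal_edges n (PM n) G"
  shows "answerable n (insert e G)"
proof -
  have p: "{1..n} = C \<union> {w, t, u}" "w \<notin> C" "t \<notin> C" "u \<notin> C" "distinct [w, t, u]"
    using assms(5) unfolding parts_def by auto
  have un: "u \<in> {1..n}" unfolding p(1) by simp
  have ham: "hamiltonian (insert e G) C" using assms(2) by (rule hamiltonian_mono) blast
  have oddC: "odd (card C)" using parts_card[OF assms(5)] assms(1) by auto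
  have uG: "u \<notin> \<Union>G" using assms(4) p by auto
  have nPM: "insert e G \<notin> PM n" "e \<notin> G" using assms(7) unfolding legal_edges_def by auto
  show ?thesis
  using assms(7,6)
  proof (cases rule: legal_edge_cases[where C = C])
    case (inside x y)
    show ?thesis
    proof (rule answerable_by_closing_isolated[OF hamiltonian_imp_traceable[OF ham], of n u])
      show "C \<subseteq> {1..n}" unfolding p(1) by blast
      show "n - 4 \<le> card C" using parts_card[OF assms(5)] by simp
      show "u \<notin> \<Union>(insert e G)" using uG inside(3) p(4) by blast
      fix f assume f: "f \<subseteq> C" "hamiltonian (insert f (insert e G)) C"
      have "mini_state n (insert f (insert e G))"
        by (rule mini_state.odd_cycle_edge[OF f(2) _ _ assms(5)]) (use assms(3,4) inside(3) f(1) in auto)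
      then show "secured n (insert f (insert e G)) \<or> mini_state n (insert f (insert e G))" ..
    qed (fact inside un p)+
  next
    case (crossing x y)
    have xyG: "{x, y} \<in> insert e G" using crossing(1) by simp
    have "matched (insert e G) (C - {x})"
      using matched_hamiltonian_delete[OF assms(2) oddC crossing(2)] by (rule matched_mono) blast
    then have "y = u \<Longrightarrow> matched (insert e G) (insert x (insert y (insert w (insert t (C - {x})))))"
      by (rule matched_add2) (use crossing(1-3) assms(3) p(2-5) in auto)
    moreover have "y = u \<Longrightarrow> insert x (insert y (insert w (insert t (C - {x})))) = {1..n}"
      using crossing(2) unfolding p(1) by auto
    ultimately have "y \<noteq> u" using legal_not_matched[OF assms(7) crossing(6)] by blast
    then obtain y' where y': "{y, y'} = {w, t}" "y \<noteq> y'"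
      using crossing(3,5) p(5) unfolding p(1) by auto
    have yy': "{y, y'} \<in> insert e G" using assms(3) y'(1) by simp
    have y'C: "y' \<notin> C" using y'(1) p(2,3) by (auto simp: doubleton_eq_iff)
    have "traceable (insert e G) (C \<union> set [y, y'])"
      by (rule hamiltonian_attach_path[OF ham crossing(2)])
        (use xyG yy' y'(2) y'C crossing(3) in \<open>auto simp: is_path_Cons is_path_Nil\<close>)
    moreover have "C \<union> set [y, y'] = insert t (insert w C)" using y'(1) by auto
    moreover have "parts n (insert t (insert w C)) [u]" by (intro parts_move assms(5))
    moreover have "u \<notin> \<Union>(insert e G)" using uG crossing(1,2) \<open>y \<noteq> u\<close> p(4) by auto
    ultimately show ?thesis
      using answerable_traceable_minus_one[OF assms(1) _ _ _ crossing(6)] by simp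
  next
    case (outside x y)
    have "e \<noteq> {w, t}" using nPM(2) assms(3) by blast
    moreover have "x \<in> {w, t, u}" "y \<in> {w, t, u}" using outside(3-6) p(1) by blast+
    ultimately consider "e = {u, w}" | "e = {u, t}" using outside(1,2) by auto
    then have "secured n (insert e G)"
    proof cases
      case 1
      have "parts n C [u, w, t]" using p(5) by (intro parts_cong[OF assms(5)]) auto
      then show ?thesis
        by (rule secured_if_hamiltonian_cherry[OF assms(1) _ ham _ _ outside(7) nPM(1)])
          (use 1 assms(3) in auto)
    next
      case 2
      have "parts n C [u, t, w]" using p(5) by (intro parts_cong[OF assms(5)]) auto
      then show ?thesis
        by (rule secured_if_hamiltonian_cherry[OF assms(1) _ ham _ _ outside(7) nPM(1)])
          (use 2 assms(3) in \<open>auto simp: insert_commute\<close>)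
    qed
    then show ?thesis unfolding answerable_def by blast
  qed
qed

text \<open>Max turns the cherry centred at \<open>w\<close> into a triangle, which is legal because
  \<open>v\<close> is still isolated.\<close>

lemma answerable_even_cycle_cherry:
  assumes "hamiltonian G C" "{w, t} \<in> G" "G \<subseteq> Pow C \<union> {{w, t}, {w, u}}" "{w, u} \<in> G"
    "parts n C [w, t, u, v]"
  shows "answerable n G"
proof (rule answerable_by_edge)
  have p: "{1..n} = C \<union> {w, t, u, v}" "w \<notin> C" "t \<notin> C" "u \<notin> C" "v \<notin> C" "distinct [w, t, u, v]"
    using assms(5) unfolding parts_def by auto
  let ?H = "insert {t, u} G"
  show "{t, u} \<subseteq> {1..n}" unfolding p(1) by blast
  show "card {t, u} = 2" using p(6) by simp
  show "{t, u} \<notin> G" using assms(3) p(3,6) by (auto simp: doubleton_eq_iff)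
  have "v \<notin> \<Union>?H" using assms(3) p(5,6) by auto
  then show "?H \<notin> PM n" by (rule isolated_imp_not_PM[rotated]) (use p(1) in blast)
  have "mini_state n ?H"
    by (rule mini_state.cycle_triangle[OF hamiltonian_mono[OF assms(1)] _ _ _ _ assms(5)])
      (use assms(2-4) in auto)
  then show "secured n ?H \<or> mini_state n ?H" ..
qed

text \<open>A chord is answered inside \<open>C\<close>. If \<open>C\<close> is joined to
  \<open>w\<close> or \<open>t\<close>, a path covers all but two vertices. If it is joined to
  \<open>u\<close> or \<open>v\<close>, Max closes the enlarged, odd set and reaches
  \<open>odd_cycle_edge\<close>. Outside \<open>C\<close>, the edge \<open>{u, v}\<close> would
  complete a perfect matching and every other new edge makes a cherry.\<close>

lemma answerable_even_cycle_edge: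
  assumes "even n" "hamiltonian G C" "{w, t} \<in> G" "G \<subseteq> Pow C \<union> {{w, t}}"
    "parts n C [w, t, u, v]" "G \<subseteq> all_edges n" "e \<in> legal_edges n (PM n) G"
  shows "answerable n (insert e G)"
proof -
  have p: "{1..n} = C \<union> {w, t, u, v}" "w \<notin> C" "t \<notin> C" "u \<notin> C" "v \<notin> C" "distinct [w, t, u, v]"
    using assms(5) unfolding parts_def by auto
  have ham: "hamiltonian (insert e G) C" using assms(2) by (rule hamiltonian_mono) blast
  have evenC: "even (card C)" using parts_card[OF assms(5)] assms(1) by auto
  have un: "u \<in> {1..n}" unfolding p(1) by simp
  have uvG: "u \<notin> \<Union>G" "v \<notin> \<Union>G" using assms(4) p by auto
  have enG: "e \<notin> G" using assms(7) unfolding legal_edges_def by auto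
  show ?thesis
    using assms(7,6)
  proof (cases rule: legal_edge_cases[where C = C])
    case (inside x y)
    show ?thesis
    proof (rule answerable_by_closing_isolated[OF hamiltonian_imp_traceable[OF ham], of n u])
      show "C \<subseteq> {1..n}" unfolding p(1) by blast
      show "n - 4 \<le> card C" using parts_card[OF assms(5)] by simp
      show "u \<notin> \<Union>(insert e G)" using uvG inside(3) p(4) by blast
      fix f assume f: "f \<subseteq> C" "hamiltonian (insert f (insert e G)) C"
      have "mini_state n (insert f (insert e G))"
        by (rule mini_state.even_cycle_edge[OF f(2) _ _ assms(5)]) (use assms(3,4) inside(3) f(1) in auto)
      then show "secured n (insert f (insert e G)) \<or> mini_state n (insert f (insert e G))" ..
    qed (fact inside un p)+
  next
    case (crossing x y)
    have xyG: "{x, y} \<in> insert e G" using crossing(1) by simp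
    have "y \<in> {w, t, u, v}" using crossing(3,5) unfolding p(1) by blast
    then consider "y \<in> {w, t}" | v' where "{y, v'} = {u, v}" "y \<noteq> v'" using p(6) by auto
    then show ?thesis
    proof cases
      case 1
      obtain y' where y': "{y, y'} = {w, t}" "y \<noteq> y'" using 1 p(6) by auto
      have yy': "{y, y'} \<in> insert e G" using assms(3) y'(1) by simp
      have y'C: "y' \<notin> C" using y'(1) p(2,3) by (auto simp: doubleton_eq_iff)
      have "traceable (insert e G) (C \<union> set [y, y'])"
        by (rule hamiltonian_attach_path[OF ham crossing(2)])
          (use xyG yy' y'(2) y'C crossing(3) in \<open>auto simp: is_path_Cons is_path_Nil\<close>)
      moreover have "C \<union> set [y, y'] = insert t (insert w C)" using y'(1) by auto
      moreover have "parts n (insert t (insert w C)) [u, v]" by (intro parts_move assms(5))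
      moreover have "\<Union>(insert e G) \<subseteq> insert t (insert w C)"
        using assms(4) crossing(1,2) 1 by auto
      ultimately show ?thesis using answerable_traceable_minus_two[OF _ _ _ crossing(6)] by simp
    next
      case (2 v')
      have v': "v' \<in> {u, v}" "y \<in> {u, v}" using 2 by auto
      have v'n: "v' \<in> {1..n}" "v' \<notin> insert y C" "v' \<notin> {w, t}" "y \<notin> {w, t}"
        unfolding p(1) using v' 2(2) p(4-6) by auto
      have "parts n C [y, w, t, v']"
      proof (rule parts_same_length[OF assms(5)])
        have "w \<in> {1..n}" "t \<in> {1..n}" unfolding p(1) by blast+
        then show "set [y, w, t, v'] \<subseteq> {1..n} - C" using v'n(1,2) crossing(3,5) p(2,3) by simp
        show "distinct [y, w, t, v']" using v'n(2-4) p(6) by auto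
      qed simp
      then have parts': "parts n (insert y C) [w, t, v']" by (rule parts_move)
      have tr: "traceable (insert e G) (insert y C)"
        by (rule hamiltonian_attach_edge[OF ham crossing(2) xyG crossing(3)])
      show ?thesis
      proof (rule answerable_by_closing_isolated[OF tr _ _ crossing(6) v'n(1,2)])
        show "insert y C \<subseteq> {1..n}" using crossing(5) p(1) by blast
        show "n - 4 \<le> card (insert y C)" using parts_card[OF parts'] by simp
        show "v' \<notin> \<Union>(insert e G)" using uvG v' v'n(2) crossing(1,2) by auto
        fix f assume f: "f \<subseteq> insert y C" "hamiltonian (insert f (insert e G)) (insert y C)"
        have "mini_state n (insert f (insert e G))"
          by (rule mini_state.odd_cycle_edge[OF f(2) _ _ parts'])
            (use assms(3,4) crossing(1,2) f(1) in auto)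
        then show "secured n (insert f (insert e G)) \<or> mini_state n (insert f (insert e G))" ..
      qed
    qed
  next
    case (outside x y)
    have "matched (insert e G) C"
      using matched_traceable[OF hamiltonian_imp_traceable[OF ham] evenC] .
    then have "e = {u, v} \<Longrightarrow> matched (insert e G) (insert w (insert t (insert u (insert v C))))"
      by (rule matched_add2) (use assms(3) p(2-6) in auto)
    moreover have "insert w (insert t (insert u (insert v C))) = {1..n}" unfolding p(1) by blast
    ultimately have "e \<noteq> {u, v}" using legal_not_matched[OF assms(7) outside(7)] by blast
    moreover have "e \<noteq> {w, t}" using enG assms(3) by blast
    moreover have "x \<in> {w, t, u, v}" "y \<in> {w, t, u, v}" using outside(3-6) p(1) by blast+
    ultimately consider "e = {w, u}" | "e = {w, v}" | "e = {t, u}" | "e = {t, v}"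
      using outside(1,2) by auto
    then show ?thesis
    proof cases
      case 1
      show ?thesis
        by (rule answerable_even_cycle_cherry[OF ham _ _ _ assms(5)]) (use assms(3,4) 1 in auto)
    next
      case 2
      have "parts n C [w, t, v, u]" using p(6) by (intro parts_cong[OF assms(5)]) auto
      then show ?thesis
        by (rule answerable_even_cycle_cherry[OF ham, rotated -1]) (use assms(3,4) 2 in auto)
    next
      case 3
      have "parts n C [t, w, u, v]" using p(6) by (intro parts_cong[OF assms(5)]) auto
      then show ?thesis
        by (rule answerable_even_cycle_cherry[OF ham, rotated -1])
          (use assms(3,4) 3 in \<open>auto simp: insert_commute\<close>)
    next
      case 4
      have "parts n C [t, w, v, u]" using p(6) by (intro parts_cong[OF assms(5)]) auto
      then show ?thesis
        by (rule answerable_even_cycle_cherry[OF ham, rotated -1])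
          (use assms(3,4) 4 in \<open>auto simp: insert_commute\<close>)
    qed
  qed
qed

text \<open>A chord is answered inside \<open>C\<close>. An edge from \<open>C\<close> to the
  triangle gives a path through all vertices but \<open>v\<close>. An edge from \<open>C\<close> to
  \<open>v\<close> makes the large part odd, and closing it leaves a cycle beside a triangle, which
  is decided. An edge from \<open>v\<close> to the triangle is illegal.\<close>

lemma answerable_cycle_triangle:
  assumes "even n" "hamiltonian G C" "{w, t} \<in> G" "{t, u} \<in> G" "{w, u} \<in> G"
    "G \<subseteq> Pow C \<union> Pow {w, t, u}" "parts n C [w, t, u, v]" "G \<subseteq> all_edges n"
    "e \<in> legal_edges n (PM n) G"
  shows "answerable n (insert e G)"
proof -
  have p: "{1..n} = C \<union> {w, t, u, v}" "w \<notin> C" "t \<notin> C" "u \<notin> C" "v \<notin> C" "distinct [w, t, u, v]"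
    using assms(7) unfolding parts_def by auto
  have ham: "hamiltonian (insert e G) C" using assms(2) by (rule hamiltonian_mono) blast
  have evenC: "even (card C)" using parts_card[OF assms(7)] assms(1) by auto
  have vn: "v \<in> {1..n}" unfolding p(1) by simp
  have vG: "v \<notin> \<Union>G" using assms(6) p(5,6) by auto
  have enG: "e \<notin> G" using assms(9) unfolding legal_edges_def by auto
  \<comment> \<open>Every vertex of the triangle starts a path through all three, so the vertex that
    Mini chooses does not matter.\<close>
  have tri: "\<exists>y' y''. {y, y', y''} = {w, t, u} \<and> distinct [y, y', y''] \<and> {y, y'} \<in> G \<and> {y', y''} \<in> G"
    if y: "y \<in> {w, t, u}" for y
  proof -
    have s: "{t, w} \<in> G" "{u, w} \<in> G" using assms(3,5) by (simp_all add: insert_commute)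
    consider "y = w" | "y = t" | "y = u" using y by blast
    then show ?thesis
    proof cases
      case 1
      then show ?thesis using assms(3,4) p(6) by (intro exI[of _ t] exI[of _ u]) auto
    next
      case 2
      then show ?thesis using assms(5) s p(6) by (intro exI[of _ w] exI[of _ u]) auto
    next
      case 3
      then show ?thesis using assms(3) s p(6) by (intro exI[of _ w] exI[of _ t]) auto
    qed
  qed
  show ?thesis
    using assms(9,8)
  proof (cases rule: legal_edge_cases[where C = C])
    case (inside x y)
    show ?thesis
    proof (rule answerable_by_closing_isolated[OF hamiltonian_imp_traceable[OF ham], of n v])
      show "C \<subseteq> {1..n}" unfolding p(1) by blast
      show "n - 4 \<le> card C" using parts_card[OF assms(7)] by simp
      show "v \<notin> \<Union>(insert e G)" using vG inside(3) p(5) by blast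
      fix f assume f: "f \<subseteq> C" "hamiltonian (insert f (insert e G)) C"
      have "mini_state n (insert f (insert e G))"
        by (rule mini_state.cycle_triangle[OF f(2) _ _ _ _ assms(7)])
          (use assms(3-6) inside(3) f(1) in auto)
      then show "secured n (insert f (insert e G)) \<or> mini_state n (insert f (insert e G))" ..
    qed (fact inside vn p)+
  next
    case (crossing x y)
    have xyG: "{x, y} \<in> insert e G" using crossing(1) by simp
    have "y \<in> {w, t, u, v}" using crossing(3,5) unfolding p(1) by blast
    then consider "y \<in> {w, t, u}" | "y = v" by blast
    then show ?thesis
    proof cases
      case 1
      obtain y' y'' where y': "{y, y', y''} = {w, t, u}" "distinct [y, y', y'']"
        "{y, y'} \<in> G" "{y', y''} \<in> G" using tri[OF 1] by blast
      have "C \<inter> {y, y', y''} = {}" unfolding y'(1) using p(2-4) by blast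
      then have "traceable (insert e G) (C \<union> set [y, y', y''])"
        by (intro hamiltonian_attach_path[OF ham crossing(2)])
          (use xyG y'(2-4) in \<open>auto simp: is_path_Cons is_path_Nil\<close>)
      moreover have "C \<union> set [y, y', y''] = insert u (insert t (insert w C))" using y'(1) by auto
      moreover have "parts n (insert u (insert t (insert w C))) [v]" by (intro parts_move assms(7))
      moreover have "v \<notin> \<Union>(insert e G)" using vG crossing(1,2) 1 p(5,6) by auto
      ultimately show ?thesis
        using answerable_traceable_minus_one[OF assms(1) _ _ _ crossing(6)] by simp
    next
      case 2
      let ?D = "insert v C"
      have tr: "traceable (insert e G) ?D"
        using hamiltonian_attach_edge[OF ham crossing(2) xyG crossing(3)] 2 by simp
      have "parts n C [v, w, t, u]" using p(6) by (intro parts_cong[OF assms(7)]) auto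
      then have parts': "parts n ?D [w, t, u]" by (rule parts_move)
      have Dn: "?D \<subseteq> {1..n}" unfolding p(1) by blast
      show ?thesis
      \<comment> \<open>No isolated vertex is left, so legality now rests on \<open>?D\<close>
        itself, an odd set with no edge to the triangle.\<close>
      proof (rule answerable_by_closing[OF tr Dn _ crossing(6) Dn])
        show "n - 4 \<le> card ?D" using parts_card[OF parts'] by simp
        show "odd (card ?D)" using parts_card[OF parts'] assms(1) by auto
        show "g \<subseteq> ?D \<or> g \<inter> ?D = {}" if "g \<in> insert e G" for g
        proof -
          have "g \<subseteq> C \<or> g \<subseteq> {w, t, u} \<or> g = {x, v}" using that assms(6) crossing(1) 2 by auto
          moreover have "{w, t, u} \<inter> ?D = {}" using p(2-6) by auto
          ultimately show ?thesis using crossing(2) by blast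
        qed
        fix f assume f: "insert f (insert e G) \<subseteq> all_edges n" "insert f (insert e G) \<notin> PM n"
          "hamiltonian (insert f (insert e G)) ?D"
        have "secured n (insert f (insert e G))"
          by (rule secured_if_hamiltonian_cherry[OF assms(1) parts' f(3) _ _ f(1,2)])
            (use assms(3,4) in auto)
        then show "secured n (insert f (insert e G)) \<or> mini_state n (insert f (insert e G))" ..
      qed simp
    qed
  next
    case (outside x y)
    have xy: "x \<in> {w, t, u, v}" "y \<in> {w, t, u, v}" using outside(3-6) p(1) by blast+
    have s: "{t, w} \<in> G" "{u, w} \<in> G" "{u, t} \<in> G" using assms(3-5) by (simp_all add: insert_commute)
    have "\<not> (x \<in> {w, t, u} \<and> y \<in> {w, t, u})" using outside(1,2) enG assms(3-5) s by auto
    then obtain z where z: "e = {z, v}" "z \<in> {w, t, u}" using xy outside(1,2) by auto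
    obtain y' y'' where y': "{z, y', y''} = {w, t, u}" "distinct [z, y', y'']" "{y', y''} \<in> G"
      using tri[OF z(2)] by blast
    have "matched (insert e G) C"
      using matched_traceable[OF hamiltonian_imp_traceable[OF ham] evenC] .
    moreover have "C \<inter> {z, y', y''} = {}" unfolding y'(1) using p(2-4) by blast
    moreover have "v \<notin> {z, y', y''}" unfolding y'(1) using p(6) by auto
    ultimately have "matched (insert e G) (insert z (insert v (insert y' (insert y'' C))))"
      by (intro matched_add2) (use z(1) y'(2,3) p(5) in auto)
    moreover have "insert z (insert v (insert y' (insert y'' C))) = {1..n}"
      using y'(1) unfolding p(1) by auto
    ultimately show ?thesis using legal_not_matched[OF assms(9) outside(7)] by blast
  qed
qed

section \<open>Max's answers while the path grows\<close>

lemma answerable_traceable: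
  assumes "traceable G U" "U \<noteq> {}" "\<Union>G \<subseteq> U" "U \<subseteq> {1..n}" "card U + 2 \<le> n"
    "G \<subseteq> all_edges n"
  shows "answerable n G"
proof -
  obtain zs where zs: "parts n U zs" using parts_exists[OF assms(4), of "[]"] by auto
  have len: "card U + length zs = n" using parts_card[OF zs] .
  then obtain u v ws where z: "zs = u # v # ws" using assms(5) by (cases zs rule: remdups_adj.cases) auto
  have p: "{1..n} = U \<union> {u, v} \<union> set ws" "u \<notin> U" "v \<notin> U" "u \<noteq> v"
    using zs unfolding z parts_def by auto
  have uvn: "u \<in> {1..n}" "v \<in> {1..n}" unfolding p(1) by blast+
  have uv: "u \<notin> \<Union>G" "v \<notin> \<Union>G" using p assms(3) by blast+
  \<comment> \<open>These are two, three or four, and at least five vertices outside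
    \<open>U\<close>. With three or four, \<open>U\<close> is large enough for a complete
    \<open>U\<close> to be decided, and closing stays within \<open>path\<close>. With at least
    five, Max can afford to absorb \<open>u\<close>.\<close>
  consider "ws = []" | "ws \<noteq> []" "length ws \<le> 2" | "3 \<le> length ws" by linarith
  then show ?thesis
  proof cases
    case 1
    then show ?thesis using answerable_traceable_minus_two[OF assms(1) _ assms(3,6)] zs z by blast
  next
    case 2
    show ?thesis
    proof (rule answerable_by_closing_isolated[OF assms(1,4) _ assms(6) uvn(1) p(2) uv(1)])
      show "n - 4 \<le> card U" using len z 2 by simp
      fix f assume f: "f \<subseteq> U" "hamiltonian (insert f G) U"
      have "card U + 3 \<le> n" using len z 2 by (cases ws) auto
      then have "mini_state n (insert f G)"
        by (intro mini_state.path[OF hamiltonian_imp_traceable[OF f(2)] assms(2) _ assms(4)])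
          (use f(1) assms(3) in blast)
      then show "secured n (insert f G) \<or> mini_state n (insert f G)" ..
    qed
  next
    case 3
    obtain z where z': "z \<in> U" "\<forall>H ys. G \<subseteq> H \<longrightarrow> is_path H ys \<longrightarrow> ys \<noteq> []
        \<longrightarrow> U \<inter> set ys = {} \<longrightarrow> {z, hd ys} \<in> H \<longrightarrow> traceable H (U \<union> set ys)"
      using traceable_end[OF assms(1,2)] by blast
    let ?H = "insert {z, u} G"
    have "traceable ?H (U \<union> set [u])"
      by (rule z'(2)[rule_format]) (use p(2) in \<open>auto simp: is_path_Cons is_path_Nil\<close>)
    then have "mini_state n ?H"
    proof (rule mini_state.path)
      have "finite U" using assms(4) by (rule finite_subset) simp
      then show "card (U \<union> set [u]) + 3 \<le> n" using len z 3 p(2) by simp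
      show "\<Union>?H \<subseteq> U \<union> set [u]" using assms(3) z'(1) by auto
      show "U \<union> set [u] \<subseteq> {1..n}" using assms(4) uvn(1) by simp
    qed simp
    moreover have "?H \<notin> PM n"
      by (rule isolated_imp_not_PM[OF uvn(2)]) (use z'(1) p(3,4) uv in blast)
    moreover have "{z, u} \<subseteq> {1..n}" using z'(1) assms(4) uvn(1) by blast
    moreover have "{z, u} \<notin> G" using uv(1) by blast
    moreover have "card {z, u} = 2" using z'(1) p(2) by (auto simp: card_insert_if)
    ultimately show ?thesis using answerable_by_edge by blast
  qed
qed

lemma answerable_path:
  assumes "traceable G U" "U \<noteq> {}" "\<Union>G \<subseteq> U" "U \<subseteq> {1..n}" "card U + 3 \<le> n"
    "G \<subseteq> all_edges n" "e \<in> legal_edges n (PM n) G"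
  shows "answerable n (insert e G)"
proof -
  have tr: "traceable (insert e G) U" using assms(1) by (rule traceable_mono) blast
  have fin: "finite U" using assms(4) by (rule finite_subset) simp
  show ?thesis
    using assms(7,6)
  proof (cases rule: legal_edge_cases[where C = U])
    case (inside x y)
    show ?thesis
      by (rule answerable_traceable[OF tr assms(2) _ assms(4)])
        (use inside(3,4) assms(3,5) in auto)
  next
    case (crossing x y)
    have xyG: "{x, y} \<in> insert e G" using crossing(1) by simp
    have yU: "insert y U \<subseteq> {1..n}" using crossing(5) assms(4) by blast
    have sub: "\<Union>(insert e G) \<subseteq> insert y U" using assms(3) crossing(1,2) by auto
    have cyU: "card (insert y U) = card U + 1" using fin crossing(3) by simp
    from traceable_pendant[OF tr crossing(2,3) xyG] show ?thesis
    proof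
      assume "traceable (insert e G) (insert y U)"
      then show ?thesis
        by (rule answerable_traceable[OF _ _ sub yU _ crossing(6)]) (use cyU assms(5) in auto)
    next
      assume "\<exists>f. f \<subseteq> U \<and> card f = 2 \<and> f \<notin> insert e G \<and> hamiltonian (insert f (insert e G)) U"
      then obtain f where f: "f \<subseteq> U" "card f = 2" "f \<notin> insert e G"
        "hamiltonian (insert f (insert e G)) U" by blast
      let ?H = "insert f (insert e G)"
      have xyH: "{x, y} \<in> ?H" using xyG by simp
      have subH: "\<Union>?H \<subseteq> insert y U" using sub f(1) by auto
      obtain zs where zs: "parts n U ([y] @ zs)"
        using parts_exists[OF assms(4), of "[y]"] crossing(3,5) by auto
      then obtain u v ws where z: "zs = u # v # ws"
        using assms(5) parts_card[OF zs] by (cases zs rule: remdups_adj.cases) auto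
      have "mini_state n ?H"
      \<comment> \<open>Cycle plus pendant vertex is traceable again, but \<open>path\<close> needs
        three vertices outside. If only two remain, \<open>cycle_pendant\<close> takes over.\<close>
      proof (cases "card U + 3 = n")
        case True
        then have "ws = []" using parts_card[OF zs] z by (cases ws) auto
        then show ?thesis using mini_state.cycle_pendant[OF f(4) crossing(2) xyH subH] zs z by simp
      next
        case False
        then show ?thesis
          by (intro mini_state.path[OF hamiltonian_attach_edge[OF f(4) crossing(2) xyH crossing(3)] _ subH yU])
            (use cyU assms(5) in auto)
      qed
      moreover have "?H \<notin> PM n"
      proof (rule isolated_imp_not_PM[of u])
        have "{1..n} = U \<union> ({y, u, v} \<union> set ws)" "u \<notin> insert y U"
          using zs unfolding z parts_def by auto
        then show "u \<in> {1..n}" "u \<notin> \<Union>?H" using subH by blast+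
      qed
      moreover have "f \<subseteq> {1..n}" using f(1) assms(4) by blast
      ultimately show ?thesis using answerable_by_edge f(2,3) by blast
    qed
  next
    case (outside x y)
    obtain zs where zs: "parts n U ([x, y] @ zs)"
      using parts_exists[OF assms(4), of "[x, y]"] outside(2-6) by auto
    have len: "card U + 2 + length zs = n" using parts_card[OF zs] by simp
    then obtain u ws where z: "zs = u # ws" using assms(5) by (cases zs) auto
    have p: "{1..n} = U \<union> ({x, y, u} \<union> set ws)" "u \<notin> U" "u \<noteq> x" "u \<noteq> y"
      using zs unfolding z parts_def by auto
    have un: "u \<in> {1..n}" unfolding p(1) by blast
    have uG: "u \<notin> \<Union>(insert e G)" using p(2-4) assms(3) outside(1) by auto
    have GP: "insert e G \<subseteq> Pow U \<union> {{x, y}}" using assms(3) outside(1) by auto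
    show ?thesis
    \<comment> \<open>The condition says that at least five vertices lie outside \<open>U\<close>,
      so three remain after absorbing \<open>x\<close> and \<open>y\<close>. Otherwise three or four
      lie outside; Max closes \<open>U\<close> and keeps \<open>{x, y}\<close> as a separate edge,
      and the number of isolated vertices decides between the odd and the even cycle state.\<close>
    proof (cases "card U + 4 \<le> n \<and> card U + 4 \<noteq> n")
      case False
      show ?thesis
      proof (rule answerable_by_closing_isolated[OF tr assms(4) _ outside(7) un p(2) uG])
        show "n - 4 \<le> card U" using False by auto
        fix f assume f: "f \<subseteq> U" "hamiltonian (insert f (insert e G)) U"
        let ?H = "insert f (insert e G)"
        have H: "{x, y} \<in> ?H" "?H \<subseteq> Pow U \<union> {{x, y}}" using outside(1) GP f(1) by auto
        consider "ws = []" | v where "ws = [v]"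
        proof (cases ws)
          case (Cons v vs)
          then have "vs = []" using False len z by auto
          then show thesis using that(2) Cons by simp
        qed (use that in simp)
        then have "mini_state n ?H"
        proof cases
          case 1
          then show ?thesis using mini_state.odd_cycle_edge[OF f(2) H] zs z by simp
        next
          case (2 v)
          then show ?thesis using mini_state.even_cycle_edge[OF f(2) H] zs z by simp
        qed
        then show "secured n ?H \<or> mini_state n ?H" ..
      qed
    next
      case True
      obtain z' where z': "z' \<in> U" "\<forall>H ys. G \<subseteq> H \<longrightarrow> is_path H ys \<longrightarrow> ys \<noteq> []
          \<longrightarrow> U \<inter> set ys = {} \<longrightarrow> {z', hd ys} \<in> H \<longrightarrow> traceable H (U \<union> set ys)"
        using traceable_end[OF assms(1,2)] by blast
      let ?H = "insert {z', x} (insert e G)"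
      have "traceable ?H (U \<union> set [x, y])"
        by (rule z'(2)[rule_format]) (use outside(1-4) in \<open>auto simp: is_path_Cons is_path_Nil\<close>)
      then have "mini_state n ?H"
      proof (rule mini_state.path)
        have "card (U \<union> set [x, y]) = card U + 2" using fin outside(2-4) by simp
        then show "card (U \<union> set [x, y]) + 3 \<le> n" using True by simp
        show "\<Union>?H \<subseteq> U \<union> set [x, y]" using assms(3) z'(1) outside(1) by auto
        show "U \<union> set [x, y] \<subseteq> {1..n}" using assms(4) outside(5,6) by simp
      qed simp
      moreover have "?H \<notin> PM n"
        by (rule isolated_imp_not_PM[OF un]) (use z'(1) p(2,3) uG in blast)
      moreover have "{z', x} \<subseteq> {1..n}" using z'(1) assms(4) outside(5) by blast
      moreover have "{z', x} \<notin> insert e G"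
        using assms(3) z'(1) outside(1-4) by (auto simp: doubleton_eq_iff)
      moreover have "card {z', x} = 2" using z'(1) outside(3) by (auto simp: card_insert_if)
      ultimately show ?thesis using answerable_by_edge[of "{z', x}" n "insert e G"] by blast
    qed
  qed
qed

section \<open>Assembly of the strategy and the opening moves\<close>

lemma mini_state_answerable:
  assumes "even n" "mini_state n G" "G \<subseteq> all_edges n" "e \<in> legal_edges n (PM n) G"
  shows "answerable n (insert e G)"
  using assms(2)
proof cases
  case (path U)
  show ?thesis by (rule answerable_path[OF path assms(3,4)])
next
  case (cycle C u v)
  show ?thesis by (rule answerable_cycle[OF assms(1) cycle assms(3,4)])
next
  case (cycle_pendant C p w u v)
  show ?thesis by (rule answerable_cycle_pendant[OF assms(1) cycle_pendant assms(3,4)])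
next
  case (odd_cycle_edge C w t u)
  show ?thesis by (rule answerable_odd_cycle_edge[OF assms(1) odd_cycle_edge assms(3,4)])
next
  case (even_cycle_edge C w t u v)
  show ?thesis by (rule answerable_even_cycle_edge[OF assms(1) even_cycle_edge assms(3,4)])
next
  case (cycle_triangle C w t u v)
  show ?thesis by (rule answerable_cycle_triangle[OF assms(1) cycle_triangle assms(3,4)])
qed

lemma mini_state_score:
  assumes "even n" "mini_state n G" "G \<subseteq> all_edges n"
  shows "(n - 4) choose 2 \<le> score_from n (PM n) Mini G"
\<comment> \<open>The inclusion in \<open>all_edges n\<close> is carried along because the clauses
  of \<open>mini_state\<close> restrict which vertices occur, but do not force every member of
  \<open>G\<close> to have two elements.\<close>
proof (rule score_from_Mini_strategy[of "\<lambda>G. mini_state n G \<and> G \<subseteq> all_edges n"])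
  fix G e assume G: "mini_state n G \<and> G \<subseteq> all_edges n" and e: "e \<in> legal_edges n (PM n) G"
  have "answerable n (insert e G)" using mini_state_answerable[OF assms(1)] G e by blast
  moreover have "insert f (insert e G) \<subseteq> all_edges n" if "f \<in> legal_edges n (PM n) (insert e G)" for f
    using that G e unfolding legal_edges_def by blast
  ultimately show "(n - 4) choose 2 \<le> score_from n (PM n) Maxi (insert e G) \<or>
      (\<exists>f\<in>legal_edges n (PM n) (insert e G).
        (mini_state n (insert f (insert e G)) \<and> insert f (insert e G) \<subseteq> all_edges n) \<or>
        (n - 4) choose 2 \<le> score_from n (PM n) Mini (insert f (insert e G)))"
    unfolding answerable_def secured_def by blast
qed (use assms mini_state_final in auto)

theorem theorem1p6:
  fixes n :: nat
  assumes "even n" and "n \<ge> 8"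
  shows "score n (PM n) Mini \<ge> (n - 4) choose 2 \<and> score n (PM n) Maxi \<ge> (n - 4) choose 2"
proof
  \<comment> \<open>A single vertex counts as a path, so the empty graph is already a
    \<open>path\<close> state.\<close>
  have "mini_state n {}"
    by (rule mini_state.path[of _ "{1}"])
      (use assms in \<open>auto simp: traceable_def is_path_def intro!: exI[of _ "[1]"]\<close>)
  then show "score n (PM n) Mini \<ge> (n - 4) choose 2"
    unfolding score_def using mini_state_score[OF assms(1)] by simp
  \<comment> \<open>Moving first, Max plays an arbitrary edge, here \<open>{1, 2}\<close>; the
    isolated vertex 3 makes it legal, and Mini then faces a \<open>path\<close> state.\<close>
  have "mini_state n {{1, 2}}"
    by (rule mini_state.path[of _ "{1, 2}"])
      (use assms in \<open>auto simp: traceable_def is_path_def intro!: exI[of _ "[1, 2]"]\<close>)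
  moreover have e: "{1, 2} \<in> all_edges n" using assms unfolding all_edges_def by auto
  ultimately have "(n - 4) choose 2 \<le> score_from n (PM n) Mini (insert {1, 2} {})"
    using mini_state_score[OF assms(1)] by simp
  moreover have "{{1, 2}} \<notin> PM n" by (rule isolated_imp_not_PM[of 3]) (use assms in auto)
  then have "{1, 2} \<in> legal_edges n (PM n) {}" using e unfolding legal_edges_def by blast
  ultimately show "score n (PM n) Maxi \<ge> (n - 4) choose 2"
    unfolding score_def by (intro score_from_Maxi_ge)
qed

end
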